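(* Let $\Gamma$ be a Moore graph of diameter $2$ and valency $57$ (if one exists). Then there exist nonnegative integers $e_1,e_2,e_3$ such that \[ K(\Gamma) \cong (\mathbb{Z}/2\mathbb{Z})^{1728} \oplus (\mathbb{Z}/13\mathbb{Z})^{1519} \oplus (\mathbb{Z}/5\mathbb{Z})^{e_1} \oplus (\mathbb{Z}/5^2\mathbb{Z})^{e_2} \oplus (\mathbb{Z}/5^3\mathbb{Z})^{e_3}. \]
   Context: A Moore graph of diameter $d$ and valency $k$ is a simple $k$-regular graph of diameter $d$ and girth $2d+1$. For a simple graph $\Gamma$ with adjacency matrix $A$ and diagonal degree matrix $D$, the Laplacian matrix is $L=D-A$, viewed as a homomorphism $\mathbb{Z}^{V(\Gamma)}\to\mathbb{Z}^{V(\Gamma)}$. The critical group $K(\Gamma)$ is the torsion subgroup of $\operatorname{coker} L=\mathbb{Z}^{V(\Gamma)}/\operatorname{im}(L)$. *)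

theory Defs
  imports
    "HOL-Algebra.Product_Groups"
    "Graph_Theory.Shortest_Path"
    "Graph_Theory.Pair_Digraph"
begin

text \<open>Finite simple graphs are represented by \<^locale>\<open>pair_graph\<close>: an undirected edge
  between \<open>u\<close> and \<open>v\<close> is the pair of arcs \<open>(u, v)\<close>, \<open>(v, u)\<close>. Hence the degree of
  a vertex is its out-degree.\<close>

definition regular_graph :: "'a pair_pre_digraph \<Rightarrow> nat \<Rightarrow> bool" where
  "regular_graph G k \<longleftrightarrow> (\<forall>v \<in> pverts G. out_degree (with_proj G) v = k)"

text \<open>\<open>wf_digraph.\<mu>\<close> with unit weights is the usual distance (infinite between
  different components).\<close>

definition graph_diameter :: "'a pair_pre_digraph \<Rightarrow> ereal" where
  "graph_diameter G =
     (SUP (u, v) \<in> pverts G \<times> pverts G. wf_digraph.\<mu> (with_proj G) (\<lambda>_. 1) u v)"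

text \<open>The bound \<open>3 \<le> length p\<close> excludes the directed cycles \<open>u \<rightarrow> v \<rightarrow> u\<close>, which
  traverse a single undirected edge twice.\<close>

definition girth :: "'a pair_pre_digraph \<Rightarrow> enat" where
  "girth G =
     (INF p \<in> {p. pre_digraph.cycle (with_proj G) p \<and> 3 \<le> length p}. enat (length p))"

definition moore_graph :: "'a pair_pre_digraph \<Rightarrow> nat \<Rightarrow> nat \<Rightarrow> bool" where
  "moore_graph G d k \<longleftrightarrow>
     pair_graph G \<and> regular_graph G k \<and>
     graph_diameter G = ereal (real d) \<and> girth G = enat (2 * d + 1)"

definition adjacency_matrix :: "'a pair_pre_digraph \<Rightarrow> 'a \<Rightarrow> 'a \<Rightarrow> int" where
  "adjacency_matrix G u v = (if (u, v) \<in> parcs G then 1 else 0)"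

definition degree_matrix :: "'a pair_pre_digraph \<Rightarrow> 'a \<Rightarrow> 'a \<Rightarrow> int" where
  "degree_matrix G u v = (if u = v then int (out_degree (with_proj G) u) else 0)"

definition laplacian_matrix :: "'a pair_pre_digraph \<Rightarrow> 'a \<Rightarrow> 'a \<Rightarrow> int" where
  "laplacian_matrix G u v = degree_matrix G u v - adjacency_matrix G u v"

definition vertex_group :: "'a pair_pre_digraph \<Rightarrow> ('a \<Rightarrow> int) monoid" where
  "vertex_group G = product_group (pverts G) (\<lambda>_. integer_group)"

definition laplacian_map :: "'a pair_pre_digraph \<Rightarrow> ('a \<Rightarrow> int) \<Rightarrow> ('a \<Rightarrow> int)" where
  "laplacian_map G x = (\<lambda>u \<in> pverts G. \<Sum>v \<in> pverts G. laplacian_matrix G u v * x v)"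

definition laplacian_cokernel :: "'a pair_pre_digraph \<Rightarrow> ('a \<Rightarrow> int) set monoid" where
  "laplacian_cokernel G = vertex_group G Mod (laplacian_map G ` carrier (vertex_group G))"

definition torsion_subgroup :: "('a, 'b) monoid_scheme \<Rightarrow> 'a set" where
  "torsion_subgroup H = {x \<in> carrier H. \<exists>n::nat. 0 < n \<and> x [^]\<^bsub>H\<^esub> n = \<one>\<^bsub>H\<^esub>}"

definition critical_group :: "'a pair_pre_digraph \<Rightarrow> ('a \<Rightarrow> int) set monoid" where
  "critical_group G =
     (laplacian_cokernel G)\<lparr>carrier := torsion_subgroup (laplacian_cokernel G)\<rparr>"

definition cyclic_power :: "nat \<Rightarrow> nat \<Rightarrow> (nat \<Rightarrow> int) monoid" where
  "cyclic_power n e = product_group {..<e} (\<lambda>_. integer_mod_group n)"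

end

theory Submission
  imports Defs "HOL-Algebra.Multiplicative_Group" "HOL-Number_Theory.Cong"
    "HOL-Library.Function_Algebras"
begin

text \<open>
  The Laplacian satisfies \<open>L\<^sup>2 - 115 L + 3250 I = J\<close> with \<open>J\<close> the all-ones matrix and 3250 the number
  of vertices. So the torsion of the cokernel consists of the classes of the vectors of sum zero,
  and it is killed by \<open>3250 = 2 * 13 * 5\<^sup>3\<close>; only the ranks of its 2- and 13-parts are at issue.
  For a prime \<open>p\<close>, sending a vector \<open>x\<close> in the kernel of \<open>L\<close> modulo \<open>p\<close> to the class of
  \<open>L x / p\<close> shows that the \<open>p\<close>-rank is one less than the nullity of \<open>L\<close> modulo \<open>p\<close>.
  Over the rationals, traces give the eigenvalues 50 and 65 of \<open>L\<close> the multiplicities 1729 and 1520,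
  and nullities can only grow under reduction modulo \<open>p\<close>. For \<open>p = 2\<close> and \<open>p = 13\<close> one of the two
  eigenvalues vanishes modulo \<open>p\<close> and the other, \<open>m\<close>, does not; the two eigenspaces modulo \<open>p\<close> are
  independent, and they do not span everything because \<open>L (L - m) = J\<close> is nonzero modulo \<open>p\<close>.
  As \<open>1729 + 1520 = 3250 - 1\<close>, the lower bounds for the nullities are attained.
\<close>

section \<open>Ranks and kernels modulo a prime\<close>

lemma vector_space_fun: "vector_space (\<lambda>(c::'f::field) (f::'a \<Rightarrow> 'f) x. c * f x)"
  by unfold_locales (auto simp: fun_eq_iff algebra_simps)

lemma sum_fun_apply: "(\<Sum>i\<in>I. f i) x = (\<Sum>i\<in>I. f i x)"
  by (induction I rule: infinite_finite_induct) auto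

text \<open>Extended by zero outside \<open>V\<close>, so that columns live in the vector space of
  all functions on the type.\<close>

definition column :: "'a set \<Rightarrow> ('a \<Rightarrow> 'a \<Rightarrow> 'f::field) \<Rightarrow> 'a \<Rightarrow> 'a \<Rightarrow> 'f" where
  "column V E v = (\<lambda>u. if u \<in> V then E u v else 0)"

text \<open>Factor \<open>E = B R\<close> with \<open>B\<close> a basis of the column space and
  \<open>R\<close> the coordinates of the columns. Since \<open>E\<close> acts as \<open>t\<close>
  on its column space, \<open>R B = t I\<close>, and the trace of \<open>B R\<close> is that of
  \<open>R B\<close>, namely \<open>t\<close> times the rank.\<close>

lemma dim_columns_eq_trace:
  fixes E :: "'a \<Rightarrow> 'a \<Rightarrow> 'f::field"
  assumes V: "finite V" and t: "t \<noteq> 0"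
    and idem: "\<And>u v. u \<in> V \<Longrightarrow> v \<in> V \<Longrightarrow> (\<Sum>w\<in>V. E u w * E w v) = t * E u v"
  shows "of_nat (vector_space.dim (\<lambda>c f x. c * f x) (column V E ` V)) * t = (\<Sum>v\<in>V. E v v)"
proof -
  interpret vector_space "\<lambda>(c::'f) (f::'a \<Rightarrow> 'f) x. c * f x" by (rule vector_space_fun)
  let ?C = "column V E ` V"
  obtain B where B: "B \<subseteq> ?C" "independent B" "?C \<subseteq> span B" "card B = dim ?C"
    using basis_exists by blast
  have fB: "finite B" using B(1) V finite_subset by blast
  let ?r = "representation B"
  have exp: "column V E v u = (\<Sum>b\<in>B. ?r (column V E v) b * b u)" if "v \<in> V" for u v
  proof -
    have "(\<Sum>b\<in>B. (\<lambda>x. ?r (column V E v) b * b x)) = column V E v"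
      using sum_representation_eq[OF B(2) _ fB order_refl, of "column V E v"] B(3) that by blast
    then show ?thesis by (metis (no_types, lifting) sum_fun_apply sum.cong)
  qed
  \<comment> \<open>The diagonal entries of \<open>R B\<close>: as \<open>b\<close> is itself a
    column of \<open>E\<close>, the combination of all columns with coefficients \<open>b v\<close>
    is \<open>E b = t b\<close>; now compare coordinates at \<open>b\<close>.\<close>
  have one: "(\<Sum>v\<in>V. b v * ?r (column V E v) b) = t" if b: "b \<in> B" for b
  proof -
    obtain v0 where v0: "v0 \<in> V" "b = column V E v0" using b B(1) by blast
    have eq: "(\<Sum>v\<in>V. (\<lambda>x. b v * column V E v x)) = (\<lambda>x. t * b x)"
      using idem v0 by (auto simp: fun_eq_iff sum_fun_apply column_def mult.commute)
    have "t * ?r b b = ?r (\<lambda>x. t * b x) b"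
      using representation_scale[OF B(2), of b t] b by (simp add: span_base)
    also have "\<dots> = ?r (\<Sum>v\<in>V. (\<lambda>x. b v * column V E v x)) b" by (simp add: eq)
    also have "\<dots> = (\<Sum>v\<in>V. ?r (\<lambda>x. b v * column V E v x) b)"
      by (subst representation_sum[OF B(2)]) (use B(3) in \<open>auto intro!: span_scale\<close>)
    also have "\<dots> = (\<Sum>v\<in>V. b v * ?r (column V E v) b)"
      by (rule sum.cong[OF refl], subst representation_scale[OF B(2)]) (use B(3) in auto)
    finally show ?thesis using representation_basis[OF B(2) b] by simp
  qed
  have "(\<Sum>v\<in>V. E v v) = (\<Sum>v\<in>V. column V E v v)" by (simp add: column_def)
  also have "\<dots> = (\<Sum>v\<in>V. \<Sum>b\<in>B. ?r (column V E v) b * b v)"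
    using exp by (intro sum.cong) auto
  also have "\<dots> = (\<Sum>b\<in>B. \<Sum>v\<in>V. b v * ?r (column V E v) b)"
    by (subst sum.swap) (simp add: mult.commute)
  also have "\<dots> = of_nat (card B) * t" using one by simp
  finally show ?thesis by (simp add: B(4))
qed

text \<open>Independence over the rationals, phrased with integer coefficients so that it can be
  compared with independence modulo a prime.\<close>

definition independent_columns :: "'a set \<Rightarrow> ('a \<Rightarrow> 'a \<Rightarrow> int) \<Rightarrow> 'a set \<Rightarrow> bool" where
  "independent_columns V M S \<longleftrightarrow>
     (\<forall>c. (\<forall>u\<in>V. (\<Sum>v\<in>S. M u v * c v) = 0) \<longrightarrow> (\<forall>v\<in>S. c v = 0))"

lemma common_denominator:
  fixes f :: "'a \<Rightarrow> rat"
  assumes "finite S"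
  obtains d :: int and g :: "'a \<Rightarrow> int" where "d \<noteq> 0" "\<And>x. x \<in> S \<Longrightarrow> of_int d * f x = of_int (g x)"
proof -
  have "\<exists>d::int. \<exists>g::'a\<Rightarrow>int. d \<noteq> 0 \<and> (\<forall>x\<in>S. of_int d * f x = of_int (g x))"
    using assms
  proof (induction S)
    case empty show ?case by (intro exI[of _ 1]) auto
  next
    case (insert a S)
    then obtain d g where dg: "d \<noteq> 0" "\<forall>x\<in>S. of_int d * f x = of_int (g x)" by blast
    obtain m k where mk: "f a = of_int m / of_int k" "k > 0"
      by (metis quotient_of_div quotient_of_denom_pos surj_pair)
    show ?case
      by (intro exI[of _ "d * k"] exI[of _ "\<lambda>x. if x = a then d * m else k * g x"])
        (use dg mk insert in \<open>auto simp: mult.assoc mult.left_commute[of "of_int d"]\<close>)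
  qed
  then show ?thesis using that by blast
qed

text \<open>The columns of \<open>M = a E + b J\<close> lie in the span of the columns of
  \<open>E\<close>, a space of dimension \<open>r\<close> by the trace formula, and of the all-ones
  vector, which accounts for the \<open>+ 1\<close>.\<close>

lemma card_independent_columns_le:
  fixes M :: "'a \<Rightarrow> 'a \<Rightarrow> int" and E :: "'a \<Rightarrow> 'a \<Rightarrow> rat"
  assumes V: "finite V" and t: "t \<noteq> 0"
    and idem: "\<And>u v. u \<in> V \<Longrightarrow> v \<in> V \<Longrightarrow> (\<Sum>w\<in>V. E u w * E w v) = t * E u v"
    and M: "\<And>u v. u \<in> V \<Longrightarrow> v \<in> V \<Longrightarrow> of_int (M u v) = a * E u v + b"
    and trace: "(\<Sum>v\<in>V. E v v) = of_nat r * t"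
    and S: "S \<subseteq> V" "independent_columns V M S"
  shows "card S \<le> r + 1"
proof -
  interpret vector_space "\<lambda>(c::rat) (f::'a \<Rightarrow> rat) x. c * f x" by (rule vector_space_fun)
  let ?C = "column V E ` V" and ?m = "column V (\<lambda>u v. of_int (M u v) :: rat)"
  let ?o = "(\<lambda>u. if u \<in> V then 1 else 0) :: 'a \<Rightarrow> rat"
  have fS: "finite S" using S V finite_subset by blast
  have "of_nat (dim ?C) * t = of_nat r * t"
    using dim_columns_eq_trace[OF V t idem] trace by simp
  then have dimC: "dim ?C = r" using t by simp
  obtain B where B: "B \<subseteq> ?C" "independent B" "?C \<subseteq> span B" "card B = dim ?C"
    using basis_exists by blast
  have fB: "finite B" using B(1) V finite_subset by blast
  have sub: "?m v \<in> span (insert ?o B)" if "v \<in> S" for v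
  proof -
    have "?m v = (\<lambda>x. a * column V E v x) + (\<lambda>x. b * ?o x)"
      using M S(1) that by (auto simp: fun_eq_iff column_def)
    moreover have "column V E v \<in> span (insert ?o B)"
      using B(3) S(1) that span_mono[of B "insert ?o B"] by blast
    ultimately show ?thesis
      by (simp only:) (intro span_add span_scale; simp add: span_base)
  qed
  \<comment> \<open>Multiplying by a common denominator turns a rational relation into an integral
    one, to which the independence of \<open>S\<close> applies.\<close>
  have key: "\<forall>v\<in>S. f v = 0" if "(\<Sum>v\<in>S. (\<lambda>x. f v * ?m v x)) = 0" for f
  proof -
    obtain d g where dg: "d \<noteq> 0" "\<And>x. x \<in> S \<Longrightarrow> of_int d * f x = of_int (g x)"
      using common_denominator[OF fS, of f] by metis
    have "(\<Sum>v\<in>S. M u v * g v) = 0" if u: "u \<in> V" for u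
    proof -
      have "(\<Sum>v\<in>S. f v * ?m v u) = 0"
        using fun_cong[OF \<open>(\<Sum>v\<in>S. (\<lambda>x. f v * ?m v x)) = 0\<close>, of u] by (simp add: sum_fun_apply)
      then have "of_int d * (\<Sum>v\<in>S. f v * of_int (M u v)) = 0"
        using u by (simp add: column_def)
      moreover have "of_int d * (\<Sum>v\<in>S. f v * of_int (M u v)) = (\<Sum>v\<in>S. of_int (M u v) * of_int (g v))"
        unfolding sum_distrib_left by (rule sum.cong) (auto simp: dg(2)[symmetric])
      ultimately have "(of_int (\<Sum>v\<in>S. M u v * g v) :: rat) = 0" by simp
      then show ?thesis by (simp only: of_int_eq_0_iff)
    qed
    then have "\<forall>v\<in>S. g v = 0" using S(2) unfolding independent_columns_def by blast
    then show ?thesis using dg by fastforce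
  qed
  \<comment> \<open>Two equal columns at distinct indices would give a relation with coefficients 1
    and -1. So passing from the index set \<open>S\<close> to the set of columns loses
    nothing.\<close>
  have inj: "inj_on ?m S"
  proof (rule inj_onI, rule ccontr)
    fix x y assume xy: "x \<in> S" "y \<in> S" "?m x = ?m y" "x \<noteq> y"
    let ?f = "\<lambda>v. if v = x then 1 else if v = y then - 1 else (0::rat)"
    have "(\<Sum>v\<in>S. (\<lambda>u. ?f v * ?m v u)) = (\<Sum>v\<in>{x,y}. (\<lambda>u. ?f v * ?m v u))"
      by (rule sum.mono_neutral_right) (use xy fS in \<open>auto simp: fun_eq_iff\<close>)
    also have "\<dots> = 0" using xy by (auto simp: fun_eq_iff)
    finally show False using key[of ?f] xy by auto
  qed
  have "independent (?m ` S)"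
  proof (rule independent_if_scalars_zero)
    fix f x assume *: "(\<Sum>x\<in>?m ` S. (\<lambda>u. f x * x u)) = 0" "x \<in> ?m ` S"
    have "(\<Sum>v\<in>S. (\<lambda>u. f (?m v) * ?m v u)) = 0"
      using *(1) by (simp add: sum.reindex[OF inj])
    then show "f x = 0" using key[of "f \<circ> ?m"] *(2) by auto
  qed (use fS in auto)
  then have "card (?m ` S) \<le> card (insert ?o B)"
    using independent_span_bound[of "insert ?o B" "?m ` S"] sub fB by blast
  also have "\<dots> \<le> card B + 1" using fB by (simp add: card_insert_if)
  finally show ?thesis using B(4) dimC card_image[OF inj] by simp
qed


section \<open>Independence and kernels modulo a prime\<close>

lemma sum_mult_mod_dvd_iff:
  fixes d :: int
  shows "d dvd (\<Sum>v\<in>V. a v * (b v mod d)) \<longleftrightarrow> d dvd (\<Sum>v\<in>V. a v * b v)"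
proof -
  have "(\<Sum>v\<in>V. a v * (b v mod d)) mod d = (\<Sum>v\<in>V. a v * (b v mod d) mod d) mod d"
    by (simp add: mod_sum_eq)
  also have "\<dots> = (\<Sum>v\<in>V. a v * b v) mod d"
    by (simp add: mod_mult_right_eq mod_sum_eq)
  finally show ?thesis by (simp add: dvd_eq_mod_eq_0)
qed

definition independent_columns_mod :: "int \<Rightarrow> 'a set \<Rightarrow> ('a \<Rightarrow> 'a \<Rightarrow> int) \<Rightarrow> 'a set \<Rightarrow> bool" where
  "independent_columns_mod d V M S \<longleftrightarrow>
     (\<forall>c. (\<forall>u\<in>V. d dvd (\<Sum>v\<in>S. M u v * c v)) \<longrightarrow> (\<forall>v\<in>S. d dvd c v))"

text \<open>Descent: the coefficients of an integral relation are all divisible by \<open>d\<close>,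
  and dividing by \<open>d\<close> gives another relation. Hence every power of \<open>d\<close>
  divides them. This is the fact that a rank cannot grow under reduction.\<close>

lemma independent_columns_modD:
  assumes d: "1 < d" and S: "independent_columns_mod d V M S"
  shows "independent_columns V M S"
  unfolding independent_columns_def
proof (intro allI impI ballI)
  fix c v assume 0: "\<forall>u\<in>V. (\<Sum>v\<in>S. M u v * c v) = 0" and v: "v \<in> S"
  have "\<forall>v\<in>S. d ^ k dvd c v" for k
  proof (induction k)
    case (Suc k)
    let ?g = "\<lambda>v. c v div d ^ k"
    have g: "c v = d ^ k * ?g v" if "v \<in> S" for v using Suc that by simp
    have "\<forall>u\<in>V. d dvd (\<Sum>v\<in>S. M u v * ?g v)"
    proof
      fix u assume "u \<in> V"
      have "d ^ k * (\<Sum>v\<in>S. M u v * ?g v) = (\<Sum>v\<in>S. M u v * c v)"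
        unfolding sum_distrib_left
        by (rule sum.cong[OF refl]) (metis g mult.left_commute)
      then have "(\<Sum>v\<in>S. M u v * ?g v) = 0" using 0 \<open>u \<in> V\<close> d by auto
      then show "d dvd (\<Sum>v\<in>S. M u v * ?g v)" by simp
    qed
    then have "\<forall>v\<in>S. d dvd ?g v"
      using S[unfolded independent_columns_mod_def, THEN spec, of ?g] by blast
    then show ?case by (metis g mult_dvd_mono dvd_refl power_Suc2)
  qed simp
  \<comment> \<open>This exponent is large enough, because \<open>d ^ n > n\<close> for
    \<open>d \<ge> 2\<close>.\<close>
  then have dv: "d ^ nat \<bar>c v\<bar> dvd c v" using v by blast
  show "c v = 0"
  proof (rule ccontr)
    assume n: "c v \<noteq> 0"
    have "int (nat \<bar>c v\<bar>) < 2 ^ nat \<bar>c v\<bar>" by (rule of_nat_less_two_power)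
    also have "\<dots> \<le> d ^ nat \<bar>c v\<bar>" using d by (intro power_mono) auto
    finally show False using dvd_imp_le_int[OF n dv] by simp
  qed
qed

text \<open>The vectors are given by their representatives in \<open>{0..<p}\<close>, so that the
  kernel is a finite set and its cardinality, \<open>p\<close> to the nullity, can stand in for a
  dimension over the field with \<open>p\<close> elements.\<close>

definition kernel_mod :: "nat \<Rightarrow> 'a set \<Rightarrow> ('a \<Rightarrow> 'a \<Rightarrow> int) \<Rightarrow> ('a \<Rightarrow> int) set" where
  "kernel_mod p V M = {x \<in> V \<rightarrow>\<^sub>E {0..<int p}. \<forall>u\<in>V. int p dvd (\<Sum>v\<in>V. M u v * x v)}"

text \<open>A maximal set \<open>S\<close> of columns independent modulo \<open>p\<close> has at
  most \<open>r\<close> elements. Each index outside \<open>S\<close> yields a kernel vector, and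
  the combinations of these vectors are pairwise distinct.\<close>

lemma card_kernel_mod_ge:
  assumes V: "finite V" and p: "prime p"
    and r: "\<And>S. S \<subseteq> V \<Longrightarrow> independent_columns V M S \<Longrightarrow> card S \<le> r"
  shows "p ^ (card V - r) \<le> card (kernel_mod p V M)"
proof -
  have p1: "1 < int p" using p prime_gt_1_nat by auto
  let ?P = "\<lambda>S. S \<subseteq> V \<and> independent_columns_mod (int p) V M S"
  have "?P {}" by (simp add: independent_columns_mod_def)
  moreover have "\<forall>S. ?P S \<longrightarrow> card S < Suc (card V)"
    by (auto simp: less_Suc_eq_le intro: card_mono[OF V])
  ultimately obtain S where S: "?P S" and max: "\<And>S'. ?P S' \<Longrightarrow> card S' \<le> card S"
    using ex_has_greatest_nat[of ?P "{}" card "Suc (card V)"] by blast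
  have fS: "finite S" using S V finite_subset by blast
  \<comment> \<open>\<open>C\<close> is the kernel vector attached to \<open>v\<close>: modulo
    \<open>p\<close> it is 1 at \<open>v\<close>, and it vanishes at all other positions outside
    \<open>S\<close>.\<close>
  let ?Q = "\<lambda>v C. (\<forall>u\<in>V. int p dvd (\<Sum>w\<in>V. M u w * C w)) \<and> [C v = 1] (mod int p)
      \<and> (\<forall>w\<in>V - S. w \<noteq> v \<longrightarrow> C w = 0)"
  have "\<exists>C. ?Q v C" if v: "v \<in> V - S" for v
  proof -
    have "\<not> independent_columns_mod (int p) V M (insert v S)"
      using max[of "insert v S"] S v fS by auto
    then obtain c where c: "\<And>u. u \<in> V \<Longrightarrow> int p dvd (\<Sum>w\<in>insert v S. M u w * c w)"
        and w: "\<exists>w\<in>insert v S. \<not> int p dvd c w"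
      unfolding independent_columns_mod_def by blast
    \<comment> \<open>Otherwise the relation would restrict to \<open>S\<close>. The coefficient at
      \<open>v\<close> is thus a unit modulo \<open>p\<close> and can be scaled to 1.\<close>
    have "\<not> int p dvd c v"
    proof
      assume d: "int p dvd c v"
      have "int p dvd (\<Sum>w\<in>S. M u w * c w)" if "u \<in> V" for u
      proof -
        have "int p dvd M u v * c v + (\<Sum>w\<in>S. M u w * c w)"
          using c[OF that] v fS by simp
        then show ?thesis using d by (simp add: dvd_add_right_iff)
      qed
      then have "\<forall>w\<in>S. int p dvd c w" using S unfolding independent_columns_mod_def by blast
      then show False using w d by blast
    qed
    then have "coprime (c v) (int p)"
      using prime_imp_coprime[of "int p" "c v"] p by (simp add: coprime_commute)
    then obtain i where i: "[c v * i = 1] (mod int p)" using cong_solve_coprime_int by blast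
    let ?C = "\<lambda>w. if w \<in> insert v S then c w * i else 0"
    have "int p dvd (\<Sum>w\<in>V. M u w * ?C w)" if "u \<in> V" for u
    proof -
      have "(\<Sum>w\<in>V. M u w * ?C w) = (\<Sum>w\<in>insert v S. M u w * ?C w)"
        by (rule sum.mono_neutral_right) (use V S v in auto)
      also have "\<dots> = (\<Sum>w\<in>insert v S. M u w * c w) * i"
        unfolding sum_distrib_right by (rule sum.cong) auto
      finally show ?thesis using c[OF that] by simp
    qed
    then show ?thesis using i v by (intro exI[of _ ?C]) auto
  qed
  then obtain C where "\<forall>v\<in>V - S. ?Q v (C v)" using bchoice[of "V - S" ?Q] by blast
  then have C: "\<And>v u. v \<in> V - S \<Longrightarrow> u \<in> V \<Longrightarrow> int p dvd (\<Sum>w\<in>V. M u w * C v w)"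
    "\<And>v. v \<in> V - S \<Longrightarrow> [C v v = 1] (mod int p)"
    "\<And>v w. v \<in> V - S \<Longrightarrow> w \<in> V - S \<Longrightarrow> w \<noteq> v \<Longrightarrow> C v w = 0"
    by blast+
  let ?D = "(V - S) \<rightarrow>\<^sub>E {0..<int p}"
  let ?x = "\<lambda>g. \<lambda>w\<in>V. (\<Sum>v\<in>V - S. g v * C v w) mod int p"
  have "?x g \<in> kernel_mod p V M" for g
  proof -
    have "int p dvd (\<Sum>w\<in>V. M u w * ?x g w)" if u: "u \<in> V" for u
    proof -
      have "(\<Sum>w\<in>V. M u w * (\<Sum>v\<in>V - S. g v * C v w)) = (\<Sum>v\<in>V - S. g v * (\<Sum>w\<in>V. M u w * C v w))"
        unfolding sum_distrib_left by (subst sum.swap) (simp add: mult.left_commute)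
      also have "int p dvd \<dots>" using C(1) u by (intro dvd_sum) auto
      finally have "int p dvd (\<Sum>w\<in>V. M u w * ((\<Sum>v\<in>V - S. g v * C v w) mod int p))"
        by (simp add: sum_mult_mod_dvd_iff)
      then show ?thesis by simp
    qed
    then show ?thesis using p1 by (auto simp: kernel_mod_def)
  qed
  moreover have "inj_on ?x ?D"
  proof -
    \<comment> \<open>The coefficients \<open>g\<close> can be read off from the coordinates outside
      \<open>S\<close>.\<close>
    have res: "?x g w = g w" if g: "g \<in> ?D" and w: "w \<in> V - S" for g w
    proof -
      have "(\<Sum>v\<in>V - S. g v * C v w) = (\<Sum>v\<in>{w}. g v * C v w)"
        by (rule sum.mono_neutral_right) (use V w C(3) in auto)
      then have "?x g w = g w * C w w mod int p" using w by simp
      also have "\<dots> = g w * 1 mod int p" using C(2)[OF w] by (metis cong_def mod_mult_right_eq)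
      finally show ?thesis using g w by (auto simp: PiE_iff)
    qed
    show ?thesis
    proof (rule inj_onI, rule PiE_ext)
      fix g g' w assume "g \<in> ?D" "g' \<in> ?D" "?x g = ?x g'" "w \<in> V - S"
      then show "g w = g' w" using res[of g w] res[of g' w] by simp
    qed
  qed
  moreover have "finite (kernel_mod p V M)"
    by (rule finite_subset[of _ "V \<rightarrow>\<^sub>E {0..<int p}"]) (use V in \<open>auto simp: kernel_mod_def intro: finite_PiE\<close>)
  ultimately have "card ?D \<le> card (kernel_mod p V M)" by (intro card_inj_on_le[of ?x]) auto
  moreover have "card ?D = p ^ (card V - card S)"
    using V S fS by (simp add: card_PiE card_Diff_subset)
  moreover have "card S \<le> r" using r[of S] S independent_columns_modD[OF p1] by blast
  then have "p ^ (card V - r) \<le> p ^ (card V - card S)"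
    using p1 by (intro power_increasing) auto
  ultimately show ?thesis by simp
qed

section \<open>Finite abelian groups of prime power exponent\<close>

context comm_group
begin

definition combination :: "'i set \<Rightarrow> ('i \<Rightarrow> 'a) \<Rightarrow> ('i \<Rightarrow> int) \<Rightarrow> 'a" where
  "combination I x f = (\<Otimes>i\<in>I. x i [^] f i)"

lemma combination_closed [simp]: "x \<in> I \<rightarrow> carrier G \<Longrightarrow> combination I x f \<in> carrier G"
  unfolding combination_def by (rule finprod_closed) auto

lemma combination_add:
  assumes "x \<in> I \<rightarrow> carrier G"
  shows "combination I x (\<lambda>i. f i + g i) = combination I x f \<otimes> combination I x g"
proof -
  have "combination I x (\<lambda>i. f i + g i) = (\<Otimes>i\<in>I. x i [^] f i \<otimes> x i [^] g i)"
    unfolding combination_def by (rule finprod_cong) (use assms in \<open>auto simp: simp_implies_def int_pow_mult Pi_iff\<close>)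
  then show ?thesis
    unfolding combination_def using assms by (simp add: Pi_iff)
qed

lemma combination_cong:
  assumes "x \<in> I \<rightarrow> carrier G" "\<And>i. i \<in> I \<Longrightarrow> x i [^] f i = y i [^] g i"
  shows "combination I x f = combination I y g"
proof -
  have "y i [^] g i \<in> carrier G" if "i \<in> I" for i
    unfolding assms(2)[OF that, symmetric] using assms(1) that by auto
  then show ?thesis
    unfolding combination_def
    by (intro finprod_cong' refl) (simp_all add: Pi_iff assms(2))
qed

lemma combination_scale:
  assumes "finite I" "x \<in> I \<rightarrow> carrier G"
  shows "combination I x (\<lambda>i. f i * n) = combination I x f [^] (n::int)"
  using assms
proof (induction I)
  case empty then show ?case by (simp add: combination_def)
next
  case (insert i I)
  then show ?case
    by (simp add: combination_def Pi_iff int_pow_distrib int_pow_pow)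
qed

lemma combination_remove:
  assumes "finite I" "x \<in> I \<rightarrow> carrier G" "j \<in> I"
  shows "combination I x f = x j [^] f j \<otimes> combination (I - {j}) x f"
proof -
  have "combination (insert j (I - {j})) x f = x j [^] f j \<otimes> combination (I - {j}) x f"
    unfolding combination_def by (rule finprod_insert) (use assms in auto)
  then show ?thesis using assms(3) by (simp add: insert_absorb)
qed

text \<open>A family rather than a set: when members are replaced the index set stays fixed, and
  repeated or trivial members do no harm.\<close>

definition generating_family :: "'i set \<Rightarrow> ('i \<Rightarrow> 'a) \<Rightarrow> bool" where
  "generating_family I x \<longleftrightarrow> x \<in> I \<rightarrow> carrier G \<and> carrier G \<subseteq> range (combination I x)"

text \<open>The assumption on \<open>k\<close> makes \<open>c j\<close> invertible as an exponent of
  \<open>x j\<close>, so \<open>x j\<close> can be recovered from the new element and the other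
  generators.\<close>

lemma generating_family_replace:
  assumes I: "finite I" "j \<in> I" and x: "generating_family I x"
    and k: "x j [^] (k * c j) = x j"
  shows "generating_family I (x(j := combination I x c))"
proof -
  let ?y = "combination I x c" and ?x = "x(j := combination I x c)" and ?R = "combination (I - {j})"
  have xc: "x \<in> I \<rightarrow> carrier G" using x by (simp add: generating_family_def)
  then have xj: "x j \<in> carrier G" and xR: "x \<in> I - {j} \<rightarrow> carrier G" using I(2) by auto
  have x'c: "?x \<in> I \<rightarrow> carrier G" using xc by auto
  have "h \<in> range (combination I ?x)" if h: "h \<in> carrier G" for h
  proof -
    obtain f where f: "h = combination I x f" using x h unfolding generating_family_def by blast
    \<comment> \<open>The power \<open>?y [^] q\<close> contributes \<open>x j [^] f j\<close>; the
      exponents \<open>c i * q\<close> that it adds at the other generators are subtracted again in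
      \<open>f'\<close>.\<close>
    define q where "q = k * f j"
    define f' where "f' = (\<lambda>i. if i = j then q else f i - c i * q)"
    have y: "?y = x j [^] c j \<otimes> ?R x c" using combination_remove[OF I(1) xc I(2)] .
    have xjq: "(x j [^] c j) [^] q = x j [^] f j"
    proof -
      have "(x j [^] c j) [^] q = (x j [^] (k * c j)) [^] f j"
        using xj by (simp add: int_pow_pow q_def mult_ac)
      then show ?thesis by (simp add: k)
    qed
    have "combination I ?x f' = ?y [^] q \<otimes> ?R ?x f'"
      using combination_remove[OF I(1) x'c I(2)] by (simp add: f'_def)
    also have "?R ?x f' = ?R x (\<lambda>i. f i - c i * q)"
      by (rule combination_cong) (use xc in \<open>auto simp: f'_def\<close>)
    also have "?y [^] q = x j [^] f j \<otimes> ?R x (\<lambda>i. c i * q)"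
      unfolding y using xj xR I(1) by (simp add: int_pow_distrib xjq combination_scale)
    also have "x j [^] f j \<otimes> ?R x (\<lambda>i. c i * q) \<otimes> ?R x (\<lambda>i. f i - c i * q) =
        x j [^] f j \<otimes> ?R x (\<lambda>i. c i * q + (f i - c i * q))"
      unfolding combination_add[OF xR] using xj xR by (simp add: m_assoc)
    also have "\<dots> = h" using combination_remove[OF I(1) xc I(2)] f by simp
    finally show ?thesis by (metis rangeI)
  qed
  then show ?thesis using x'c by (auto simp: generating_family_def)
qed

text \<open>A generating family minimising the sum of the orders is independent: a nontrivial relation,
  divided by the largest power of \<open>p\<close> dividing its coefficients, has a coefficient prime to \<open>p\<close>,
  and the generator there could be replaced by an element of smaller order.\<close>

lemma p_group_independent_generators:
  fixes p :: nat
  assumes fin: "finite (carrier G)" and p: "prime p"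
    and exp: "\<And>g. g \<in> carrier G \<Longrightarrow> g [^] (p ^ e) = \<one>"
  obtains x where "generating_family (carrier G) x"
    "\<And>f i. combination (carrier G) x f = \<one> \<Longrightarrow> i \<in> carrier G \<Longrightarrow> x i [^] f i = \<one>"
proof -
  let ?I = "carrier G"
  let ?P = "generating_family ?I"
  have "?P (\<lambda>g. g)"
    unfolding generating_family_def
  proof (intro conjI subsetI)
    fix h assume h: "h \<in> ?I"
    have "combination ?I (\<lambda>g. g) (\<lambda>g. if g = h then 1 else 0) = (\<Otimes>i\<in>?I. if h = i then i else \<one>)"
      unfolding combination_def by (rule finprod_cong) (auto simp: simp_implies_def)
    also have "\<dots> = h" using finprod_singleton[OF h fin, of "\<lambda>g. g"] by simp
    finally show "h \<in> range (combination ?I (\<lambda>g. g))" by (metis rangeI)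
  qed simp
  then obtain x where x: "?P x"
    and min: "\<And>y. ?P y \<Longrightarrow> (\<Sum>i\<in>?I. ord (x i)) \<le> (\<Sum>i\<in>?I. ord (y i))"
    using ex_has_least_nat[of ?P "\<lambda>g. g" "\<lambda>x. \<Sum>i\<in>?I. ord (x i)"] by blast
  have xc: "x \<in> ?I \<rightarrow> carrier G" using x by (simp add: generating_family_def)
  have "x i [^] m i = \<one>" if rel: "combination ?I x m = \<one>" and i: "i \<in> ?I" for m i
  proof (rule ccontr)
    assume ni: "x i [^] m i \<noteq> \<one>"
    let ?T = "{i\<in>?I. x i [^] m i \<noteq> \<one>}"
    obtain j where j: "j \<in> ?T"
      and jmin: "\<And>l. l \<in> ?T \<Longrightarrow> multiplicity (int p) (m j) \<le> multiplicity (int p) (m l)"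
      using ex_has_least_nat[of "\<lambda>j. j \<in> ?T" i "\<lambda>l. multiplicity (int p) (m l)"] i ni by blast
    define s where "s = multiplicity (int p) (m j)"
    \<comment> \<open>Factors equal to the identity are given exponent 0, so that by the choice of
      \<open>j\<close> the power \<open>p ^ s\<close> divides every exponent.\<close>
    define m' where "m' = (\<lambda>l. if l \<in> ?T then m l else 0)"
    define c where "c = (\<lambda>l. m' l div int p ^ s)"
    have m': "m' l = c l * int p ^ s" for l
    proof -
      have "int p ^ s dvd m' l"
        using jmin[of l] unfolding m'_def s_def by (auto intro: multiplicity_dvd')
      then show ?thesis by (simp add: c_def)
    qed
    have jI: "j \<in> ?I" and xj: "x j \<in> carrier G" using j xc by auto
    have mj: "m j = c j * int p ^ s" using m'[of j] j by (simp add: m'_def)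
    have "m j \<noteq> 0" using j by auto
    moreover have "\<not> is_unit (int p)" using p by auto
    ultimately obtain d where d: "m j = int p ^ s * d" "\<not> int p dvd d"
      using multiplicity_decompose'[of "m j" "int p"] unfolding s_def by blast
    then have cj: "\<not> int p dvd c j"
      using mj \<open>m j \<noteq> 0\<close> by auto
    let ?y = "combination ?I x c"
    have "?y [^] (int p ^ s) = combination ?I x m'"
      unfolding combination_scale[OF fin xc, symmetric] by (simp only: m'[symmetric])
    also have "\<dots> = combination ?I x m"
      by (rule combination_cong) (use xc in \<open>auto simp: m'_def\<close>)
    finally have "?y [^] int (p ^ s) = \<one>" using rel by simp
    then have "?y [^] (p ^ s) = \<one>" by (simp only: int_pow_int)
    then have ordy: "ord ?y \<le> p ^ s"
      using pow_eq_id[of ?y "p ^ s"] xc p by (auto intro: dvd_imp_le simp: prime_gt_0_nat)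
    \<comment> \<open>Otherwise \<open>x j [^] m j\<close> would be trivial, since
      \<open>p ^ s\<close> divides \<open>m j\<close>. As the order of \<open>x j\<close> is a power
      of \<open>p\<close>, it exceeds \<open>p ^ s\<close> and so the order of
      \<open>?y\<close>.\<close>
    have "x j [^] (p ^ s) \<noteq> \<one>"
    proof
      assume "x j [^] (p ^ s) = \<one>"
      then have "x j [^] int (p ^ s) = \<one>" by (simp only: int_pow_int)
      then have "x j [^] (int (p ^ s) * c j) = \<one>"
        using xj by (metis int_pow_pow int_pow_one)
      then show False using j mj by (simp add: mult.commute)
    qed
    then have nd: "\<not> ord (x j) dvd p ^ s" using pow_eq_id xj by blast
    have "ord (x j) dvd p ^ e" using exp[OF xj] pow_eq_id xj by blast
    then obtain b where b: "ord (x j) = p ^ b" using p by (auto simp: divides_primepow_nat)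
    have "p ^ s < ord (x j)"
      using nd b p by (metis le_imp_power_dvd not_le power_strict_increasing prime_gt_1_nat)
    then have less: "ord ?y < ord (x j)" using ordy by simp
    \<comment> \<open>This makes \<open>c j\<close> invertible modulo the order of
      \<open>x j\<close>, as needed for replacing \<open>x j\<close> by \<open>?y\<close>.\<close>
    have "coprime (c j) (int p ^ e)"
      using prime_imp_coprime[of "int p" "c j"] cj p by (simp add: coprime_commute)
    then obtain k where k: "[c j * k = 1] (mod int p ^ e)" using cong_solve_coprime_int by blast
    have "x j [^] (k * c j) = x j [^] (1::int)"
    proof -
      have "int (ord (x j)) dvd int p ^ e" using \<open>ord (x j) dvd p ^ e\<close>
        by (metis of_nat_dvd_iff of_nat_power)
      moreover have "int p ^ e dvd 1 - k * c j"
        using k by (metis cong_iff_dvd_diff cong_sym mult.commute)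
      ultimately show ?thesis using int_pow_eq[OF xj, of "k * c j" 1]
        by (metis dvd_trans dvd_diff_commute)
    qed
    then have "?P (x(j := ?y))"
      using generating_family_replace[OF fin jI x, of k c] xj by simp
    then have "(\<Sum>i\<in>?I. ord (x i)) \<le> (\<Sum>i\<in>?I. ord ((x(j := ?y)) i))" by (rule min)
    moreover have "(\<Sum>i\<in>?I. ord ((x(j := ?y)) i)) < (\<Sum>i\<in>?I. ord (x i))"
      by (rule sum_strict_mono_ex1[OF fin]) (use less jI in auto)
    ultimately show False by simp
  qed
  then show thesis using that x by blast
qed

text \<open>For independent generators \<open>x i\<close>, the map sending exponents to their
  combination is an isomorphism from the product of the cyclic groups of order
  \<open>ord (x i)\<close>; trivial factors may occur.\<close>

lemma p_group_iso_product:
  fixes p :: nat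
  assumes fin: "finite (carrier G)" and p: "prime p"
    and exp: "\<And>g. g \<in> carrier G \<Longrightarrow> g [^] (p ^ e) = \<one>"
  obtains n :: "'a \<Rightarrow> nat" where "\<And>i. i \<in> carrier G \<Longrightarrow> n i dvd p ^ e"
    "product_group (carrier G) (\<lambda>i. integer_mod_group (n i)) \<cong> G"
proof -
  obtain x where x: "generating_family (carrier G) x"
    and ind: "\<And>f i. combination (carrier G) x f = \<one> \<Longrightarrow> i \<in> carrier G \<Longrightarrow> x i [^] f i = \<one>"
    using p_group_independent_generators[OF assms] by metis
  let ?I = "carrier G" and ?n = "\<lambda>i. ord (x i)"
  have xc: "x \<in> ?I \<rightarrow> carrier G" and gen: "carrier G \<subseteq> range (combination ?I x)"
    using x by (auto simp: generating_family_def)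
  have dv: "?n i dvd p ^ e" if "i \<in> ?I" for i
    using exp pow_eq_id xc that by blast
  then have pos: "?n i > 0" if "i \<in> ?I" for i
    using p that by (metis dvd_pos_nat prime_gt_0_nat zero_less_power)
  let ?A = "product_group ?I (\<lambda>i. integer_mod_group (?n i))"
  have carA: "carrier ?A = PiE ?I (\<lambda>i. {0..<int (?n i)})"
  proof -
    have "carrier (integer_mod_group (?n i)) = {0..<int (?n i)}" if "i \<in> ?I" for i
      using pos[OF that] by (simp only: carrier_integer_mod_group) simp
    then show ?thesis unfolding carrier_product_group by (rule PiE_cong)
  qed
  \<comment> \<open>Exponents matter only modulo the orders. This gives both the homomorphism
    property and surjectivity from reduced exponents.\<close>
  have modc: "combination ?I x (\<lambda>i\<in>?I. f i mod int (?n i)) = combination ?I x f" for f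
    by (rule combination_cong[OF xc]) (use xc in \<open>auto simp: int_pow_eq Pi_iff dvd_minus_mod\<close>)
  have "combination ?I x \<in> iso ?A G"
  proof (rule isoI)
    show "combination ?I x \<in> hom ?A G"
      by (rule homI) (simp_all add: xc modc combination_add)
    show "bij_betw (combination ?I x) (carrier ?A) (carrier G)"
    proof (rule bij_betw_imageI)
      show "inj_on (combination ?I x) (carrier ?A)"
      proof (rule inj_onI)
        fix f g assume fg: "f \<in> carrier ?A" "g \<in> carrier ?A" "combination ?I x f = combination ?I x g"
        have "combination ?I x g \<otimes> combination ?I x (\<lambda>i. f i - g i) = combination ?I x f"
          by (simp add: combination_add[OF xc, symmetric])
        then have "combination ?I x (\<lambda>i. f i - g i) = \<one>"
          using fg(3) xc Units_l_cancel[of "combination ?I x g" "combination ?I x (\<lambda>i. f i - g i)" \<one>] by simp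
        then have eq: "int (?n i) dvd f i - g i" if "i \<in> ?I" for i
          using ind that xc int_pow_eq_id by blast
        show "f = g"
        proof (rule PiE_ext)
          show "f \<in> PiE ?I (\<lambda>i. {0..<int (?n i)})" "g \<in> PiE ?I (\<lambda>i. {0..<int (?n i)})"
            using fg carA by auto
          then show "f i = g i" if "i \<in> ?I" for i
            using eq[OF that] that by (metis PiE_mem atLeastLessThan_iff mod_eq_dvd_iff mod_pos_pos_trivial)
        qed
      qed
      show "combination ?I x ` carrier ?A = carrier G"
      proof
        show "combination ?I x ` carrier ?A \<subseteq> carrier G" using xc by auto
        show "carrier G \<subseteq> combination ?I x ` carrier ?A"
        proof
          fix h assume "h \<in> carrier G"
          then obtain f where "h = combination ?I x f" using gen by blast
          then have "h = combination ?I x (\<lambda>i\<in>?I. f i mod int (?n i))" by (simp add: modc)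
          moreover have "(\<lambda>i\<in>?I. f i mod int (?n i)) \<in> carrier ?A"
            unfolding carA using pos by auto
          ultimately show "h \<in> combination ?I x ` carrier ?A" by blast
        qed
      qed
    qed
  qed
  then show thesis using that[of ?n] dv by (auto simp: is_iso_def)
qed

end


section \<open>Isomorphisms between products of cyclic groups\<close>

lemma is_isoI: "h \<in> hom A B \<Longrightarrow> bij_betw h (carrier A) (carrier B) \<Longrightarrow> A \<cong> B"
  by (auto simp: is_iso_def iso_def)

lemma product_group_Un_iso:
  assumes "I \<inter> J = {}"
  shows "product_group (I \<union> J) F \<cong> product_group I F \<times>\<times> product_group J F"
proof -
  let ?h = "\<lambda>f. (restrict f I, restrict f J)"
  let ?A = "product_group (I \<union> J) F" and ?B = "product_group I F \<times>\<times> product_group J F"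
  have "?h \<in> hom ?A ?B"
    by (rule homI) (auto simp: fun_eq_iff PiE_iff)
  moreover have "bij_betw ?h (carrier ?A) (carrier ?B)"
    by (rule bij_betw_byWitness[where f' = "\<lambda>(a, b). \<lambda>i\<in>I \<union> J. if i \<in> I then a i else b i"])
      (use assms in \<open>auto simp: fun_eq_iff PiE_iff extensional_def split: if_splits\<close>)
  ultimately show ?thesis by (rule is_isoI)
qed

lemma product_group_remove_trivial_iso:
  assumes "\<And>j. j \<in> I - J \<Longrightarrow> carrier (F j) = {\<one>\<^bsub>F j\<^esub>}" "J \<subseteq> I"
  shows "product_group I F \<cong> product_group J F"
proof -
  have one: "\<one>\<^bsub>F j\<^esub> = x" if "j \<in> I" "j \<notin> J" "x \<in> carrier (F j)" for j x
    using assms(1)[of j] that by auto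
  let ?h = "\<lambda>f. restrict f J"
  let ?A = "product_group I F" and ?B = "product_group J F"
  have "?h \<in> hom ?A ?B"
    by (rule homI) (use assms(2) in \<open>auto simp: fun_eq_iff PiE_iff\<close>)
  moreover have "bij_betw ?h (carrier ?A) (carrier ?B)"
    by (rule bij_betw_byWitness[where f' = "\<lambda>a. \<lambda>i\<in>I. if i \<in> J then a i else \<one>\<^bsub>F i\<^esub>"])
      (use assms in \<open>auto simp: fun_eq_iff PiE_iff extensional_def intro: one split: if_splits\<close>)
  ultimately show ?thesis by (rule is_isoI)
qed

lemma product_group_eq_cyclic_power:
  assumes "finite I" "\<And>i. i \<in> I \<Longrightarrow> n i = m"
  shows "product_group I (\<lambda>i. integer_mod_group (n i)) \<cong> cyclic_power m (card I)"
proof -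
  obtain h where h: "bij_betw h {..<card I} I"
    using ex_bij_betw_nat_finite[OF assms(1)] by (auto simp: atLeast0LessThan)
  let ?h = "\<lambda>f. \<lambda>k\<in>{..<card I}. f (h k)" and ?g = "inv_into {..<card I} h"
  let ?A = "product_group I (\<lambda>i. integer_mod_group (n i))" and ?B = "cyclic_power m (card I)"
  have hI: "h k \<in> I" if "k < card I" for k using h that by (auto simp: bij_betw_def)
  have gI: "?g i < card I" "h (?g i) = i" if "i \<in> I" for i
    using h that inv_into_into[of i h "{..<card I}"] by (auto simp: bij_betw_def f_inv_into_f)
  have gh: "?g (h k) = k" if "k < card I" for k using h that by (auto simp: bij_betw_def)
  have "?h \<in> hom ?A ?B"
    by (rule homI) (use assms(2) hI in \<open>auto simp: fun_eq_iff PiE_iff cyclic_power_def\<close>)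
  moreover have "bij_betw ?h (carrier ?A) (carrier ?B)"
    by (rule bij_betw_byWitness[where f' = "\<lambda>a. \<lambda>i\<in>I. a (?g i)"])
      (use assms(2) hI gI gh in \<open>auto simp: fun_eq_iff PiE_iff extensional_def cyclic_power_def split: if_splits\<close>)
  ultimately show ?thesis by (rule is_isoI)
qed

lemma card_cyclic_power:
  assumes "0 < n"
  shows "card (carrier (cyclic_power n e)) = n ^ e"
  using assms by (simp add: cyclic_power_def card_PiE carrier_integer_mod_group)

section \<open>Groups of prime or cubed prime exponent, and the splitting into coprime torsion
  parts\<close>

definition torsion_part :: "('a, 'b) monoid_scheme \<Rightarrow> nat \<Rightarrow> 'a set" where
  "torsion_part G n = {x \<in> carrier G. x [^]\<^bsub>G\<^esub> n = \<one>\<^bsub>G\<^esub>}"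

context comm_group
begin

lemma exponent_prime_iso_cyclic_power:
  fixes p :: nat
  assumes fin: "finite (carrier G)" and p: "prime p"
    and exp: "\<And>g. g \<in> carrier G \<Longrightarrow> g [^] p = \<one>"
  obtains a where "G \<cong> cyclic_power p a"
proof -
  obtain n where n: "\<And>i. i \<in> carrier G \<Longrightarrow> n i dvd p"
    and iso: "product_group (carrier G) (\<lambda>i. integer_mod_group (n i)) \<cong> G"
    using p_group_iso_product[OF fin p, of 1] exp by auto
  let ?I = "{i \<in> carrier G. n i = p}"
  have "G \<cong> product_group (carrier G) (\<lambda>i. integer_mod_group (n i))"
    by (rule group.iso_sym[OF _ iso]) simp
  also have "\<dots> \<cong> product_group ?I (\<lambda>i. integer_mod_group (n i))"
  proof (rule product_group_remove_trivial_iso)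
    fix j assume "j \<in> carrier G - ?I"
    then have "n j = 1" using n[of j] p by (auto simp: prime_nat_iff)
    then show "carrier (integer_mod_group (n j)) = {\<one>\<^bsub>integer_mod_group (n j)\<^esub>}"
      by (auto simp: carrier_integer_mod_group)
  qed auto
  also have "\<dots> \<cong> cyclic_power p (card ?I)"
    by (rule product_group_eq_cyclic_power) (use fin in auto)
  finally show thesis by (rule that)
qed

text \<open>Every cyclic factor has order 1, \<open>p\<close>, \<open>p\<^sup>2\<close> or
  \<open>p ^ 3\<close>; drop the trivial ones and group the rest by order.\<close>

lemma exponent_prime_cube_iso_cyclic_powers:
  fixes p :: nat
  assumes fin: "finite (carrier G)" and p: "prime p"
    and exp: "\<And>g. g \<in> carrier G \<Longrightarrow> g [^] (p ^ 3) = \<one>"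
  obtains e1 e2 e3 where
    "G \<cong> cyclic_power p e1 \<times>\<times> cyclic_power (p\<^sup>2) e2 \<times>\<times> cyclic_power (p ^ 3) e3"
proof -
  obtain n where n: "\<And>i. i \<in> carrier G \<Longrightarrow> n i dvd p ^ 3"
    and iso: "product_group (carrier G) (\<lambda>i. integer_mod_group (n i)) \<cong> G"
    using p_group_iso_product[OF fin p, of 3] exp by auto
  define I where "I m = {i \<in> carrier G. n i = m}" for m
  let ?P = "\<lambda>J. product_group J (\<lambda>i. integer_mod_group (n i))"
  have cyc: "?P (I m) \<cong> cyclic_power m (card (I m))" for m
    by (rule product_group_eq_cyclic_power) (use fin in \<open>auto simp: I_def\<close>)
  have cases: "n i = 1 \<or> n i = p \<or> n i = p\<^sup>2 \<or> n i = p ^ 3" if i: "i \<in> carrier G" for i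
  proof -
    obtain k where k: "k \<le> 3" "n i = p ^ k"
      using n[OF i] p by (auto simp: divides_primepow_nat)
    then have "k = 0 \<or> k = 1 \<or> k = 2 \<or> k = 3" by auto
    then show ?thesis using k by auto
  qed
  have inj: "p ^ j = p ^ k \<longleftrightarrow> j = k" for j k
    using power_inject_exp[of p] prime_gt_1_nat[OF p] by blast
  have disj: "I p \<inter> (I (p\<^sup>2) \<union> I (p ^ 3)) = {}" "I (p\<^sup>2) \<inter> I (p ^ 3) = {}"
    using inj[of 1 2] inj[of 1 3] inj[of 2 3] by (auto simp: I_def)
  have "G \<cong> ?P (carrier G)"
    by (rule group.iso_sym[OF _ iso]) simp
  also have "\<dots> \<cong> ?P (I p \<union> (I (p\<^sup>2) \<union> I (p ^ 3)))"
  proof (rule product_group_remove_trivial_iso)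
    fix j assume "j \<in> carrier G - (I p \<union> (I (p\<^sup>2) \<union> I (p ^ 3)))"
    then have "n j = 1" using cases[of j] by (auto simp: I_def)
    then show "carrier (integer_mod_group (n j)) = {\<one>\<^bsub>integer_mod_group (n j)\<^esub>}"
      by (auto simp: carrier_integer_mod_group)
  qed (auto simp: I_def)
  also have "\<dots> \<cong> ?P (I p) \<times>\<times> ?P (I (p\<^sup>2) \<union> I (p ^ 3))"
    by (rule product_group_Un_iso[OF disj(1)])
  also have "\<dots> \<cong> cyclic_power p (card (I p)) \<times>\<times> cyclic_power (p\<^sup>2) (card (I (p\<^sup>2))) \<times>\<times> cyclic_power (p ^ 3) (card (I (p ^ 3)))"
    by (rule group.DirProd_iso_trans[OF _ cyc iso_trans[OF product_group_Un_iso[OF disj(2)] group.DirProd_iso_trans[OF _ cyc cyc]]])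
      simp_all
  finally show thesis by (rule that)
qed

lemma subgroup_torsion_part: "subgroup (torsion_part G n) G"
  by (rule subgroupI) (auto simp: torsion_part_def nat_pow_distrib nat_pow_inv intro: exI[of _ \<one>])

lemma comm_group_torsion_part: "comm_group (G\<lparr>carrier := torsion_part G n\<rparr>)"
  by (rule group.group_comm_groupI[OF subgroup.subgroup_is_group[OF subgroup_torsion_part is_group]])
    (auto simp: torsion_part_def m_comm)

text \<open>With Bezout coefficients \<open>u * a + v * b = 1\<close>, each \<open>g\<close> is the
  product of \<open>g [^] (b * v)\<close>, killed by \<open>a\<close>, and
  \<open>g [^] (a * u)\<close>, killed by \<open>b\<close>.\<close>

lemma torsion_part_coprime_iso:
  assumes ab: "coprime a b" and exp: "\<And>g. g \<in> carrier G \<Longrightarrow> g [^] (a * b) = \<one>"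
  shows "G \<cong> G\<lparr>carrier := torsion_part G a\<rparr> \<times>\<times> G\<lparr>carrier := torsion_part G b\<rparr>"
proof -
  let ?A = "G\<lparr>carrier := torsion_part G a\<rparr>" and ?B = "G\<lparr>carrier := torsion_part G b\<rparr>"
  let ?h = "\<lambda>(x, y). x \<otimes> y"
  interpret A: comm_group ?A by (rule comm_group_torsion_part)
  interpret B: comm_group ?B by (rule comm_group_torsion_part)
  obtain u v where uv: "u * int a + v * int b = 1"
    using ab bezout_int[of "int a" "int b"] by auto
  have pow0: "x [^] (int n * k) = \<one>" if "x \<in> torsion_part G n" for x n k
    using that by (auto simp: torsion_part_def int_pow_int simp flip: int_pow_pow)
  have hom: "?h \<in> hom (?A \<times>\<times> ?B) G"
    by (rule homI) (auto simp: torsion_part_def m_ac)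
  have ta: "x \<in> torsion_part G a \<Longrightarrow> x \<in> carrier G" for x a by (simp add: torsion_part_def)
  \<comment> \<open>The exponents \<open>b * v\<close> and \<open>a * u\<close> act as projections:
    each is the identity on one part and trivial on the other.\<close>
  have rec: "(x \<otimes> y) [^] (int b * v) = x \<and> (x \<otimes> y) [^] (int a * u) = y"
    if x: "x \<in> torsion_part G a" and y: "y \<in> torsion_part G b" for x y
  proof -
    have "x [^] (int b * v) = x [^] (int b * v) \<otimes> x [^] (int a * u)"
      using pow0[OF x] ta[OF x] by simp
    also have "\<dots> = x [^] (1::int)" using ta[OF x] uv by (simp add: mult.commute add.commute flip: int_pow_mult)
    finally have 1: "x [^] (int b * v) = x" using ta[OF x] by simp
    have "y [^] (int a * u) = y [^] (int a * u) \<otimes> y [^] (int b * v)"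
      using pow0[OF y] ta[OF y] by simp
    also have "\<dots> = y [^] (1::int)" using ta[OF y] uv by (simp add: mult.commute add.commute flip: int_pow_mult)
    finally have 2: "y [^] (int a * u) = y" using ta[OF y] by simp
    show ?thesis using 1 2 pow0[OF x] pow0[OF y] ta[OF x] ta[OF y] by (simp add: int_pow_distrib)
  qed
  have "bij_betw ?h (carrier (?A \<times>\<times> ?B)) (carrier G)"
  proof (rule bij_betw_byWitness[where f' = "\<lambda>g. (g [^] (int b * v), g [^] (int a * u))"])
    show "\<forall>g\<in>carrier G. ?h (g [^] (int b * v), g [^] (int a * u)) = g"
      using uv by (auto simp: mult.commute add.commute simp flip: int_pow_mult)
    have "(g [^] (int b * v)) [^] a = \<one>" "(g [^] (int a * u)) [^] b = \<one>" if g: "g \<in> carrier G" for g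
    proof -
      have e: "g [^] (int (a * b) * k) = \<one>" for k
        using exp[OF g] g by (metis int_pow_int int_pow_one int_pow_pow)
      show "(g [^] (int b * v)) [^] a = \<one>"
        using e[of v] g by (simp add: int_pow_pow mult_ac flip: int_pow_int)
      show "(g [^] (int a * u)) [^] b = \<one>"
        using e[of u] g by (simp add: int_pow_pow mult_ac flip: int_pow_int)
    qed
    then show "(\<lambda>g. (g [^] (int b * v), g [^] (int a * u))) ` carrier G \<subseteq> carrier (?A \<times>\<times> ?B)"
      by (auto simp: torsion_part_def)
  qed (use rec in \<open>auto simp: torsion_part_def\<close>)
  then have "?A \<times>\<times> ?B \<cong> G" using is_isoI[OF hom] by blast
  then show ?thesis
    by (rule group.iso_sym[OF DirProd_group[OF A.is_group B.is_group]])
qed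

end

section \<open>The Laplacian of a Moore graph of diameter 2\<close>

context
  fixes G :: "'a pair_pre_digraph" and k :: nat
  assumes moore: "moore_graph G 2 k"
begin

interpretation pair_graph G
  using moore by (simp add: moore_graph_def)

section \<open>Counting common neighbours; the equation of the adjacency matrix\<close>

lemma moore_cycle_length_ge: "cycle p \<Longrightarrow> 3 \<le> length p \<Longrightarrow> 5 \<le> length p"
proof -
  assume p: "cycle p" "3 \<le> length p"
  have "enat 5 = girth G" using moore by (simp add: moore_graph_def)
  also have "\<dots> \<le> enat (length p)" unfolding girth_def using p by (intro INF_lower) auto
  finally show ?thesis by simp
qed

lemma moore_no_triangle:
  assumes "(u, v) \<in> parcs G" "(v, w) \<in> parcs G" "(w, u) \<in> parcs G"
  shows False
proof -
  have "cycle [(u, v), (v, w), (w, u)]"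
    unfolding cycle_def using assms no_loops' wellformed'
    by (intro exI[of _ u]) (auto simp: awalk_simps)
  from moore_cycle_length_ge[OF this] show False by simp
qed

text \<open>The two inequalities exclude degenerate closed walks. Consequently two distinct vertices
  have at most one common neighbour.\<close>

lemma moore_no_square:
  assumes "(u, w) \<in> parcs G" "(w, v) \<in> parcs G" "(v, x) \<in> parcs G" "(x, u) \<in> parcs G"
    "u \<noteq> v" "w \<noteq> x"
  shows False
proof -
  have "cycle [(u, w), (w, v), (v, x), (x, u)]"
    unfolding cycle_def using assms no_loops' wellformed'
    by (intro exI[of _ u]) (auto simp: awalk_simps)
  from moore_cycle_length_ge[OF this] show False by simp
qed

lemma awalk_cost_one: "awalk_cost (\<lambda>_. 1) p = real (length p)"
  by (induction p) auto

lemma moore_common_neighbour_exists: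
  assumes u: "u \<in> pverts G" and v: "v \<in> pverts G" and "u \<noteq> v" "(u, v) \<notin> parcs G"
  shows "\<exists>w. (u, w) \<in> parcs G \<and> (w, v) \<in> parcs G"
proof -
  have "\<mu> (\<lambda>_. 1) u v \<le> graph_diameter G"
    unfolding graph_diameter_def by (rule SUP_upper2[of "(u, v)"]) (use u v in auto)
  \<comment> \<open>The distance is an infimum; a strict bound by 3 yields an actual walk of length
    at most 2.\<close>
  also have "\<dots> < ereal 3" using moore by (simp add: moore_graph_def)
  finally obtain p where p: "awalk u p v" "ereal (awalk_cost (\<lambda>_. 1) p) < ereal 3"
    unfolding \<mu>_def INF_less_iff by auto
  then have len: "length p < 3" by (simp add: awalk_cost_one)
  show ?thesis
  proof (cases p)
    case Nil then show ?thesis using p assms by (simp add: awalk_simps)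
  next
    case (Cons e q)
    then obtain e' where "q = [e']" using p len assms(4)
      by (cases q) (auto simp: awalk_simps)
    then show ?thesis using p Cons by (cases e; cases e') (auto simp: awalk_simps)
  qed
qed

lemma card_neighbours: "u \<in> pverts G \<Longrightarrow> card {w. (u, w) \<in> parcs G} = k"
proof -
  assume "u \<in> pverts G"
  then have "k = card (out_arcs (with_proj G) u)"
    using moore by (simp add: moore_graph_def regular_graph_def out_degree_def)
  also have "out_arcs (with_proj G) u = Pair u ` {w. (u, w) \<in> parcs G}"
    by (auto simp: out_arcs_def)
  also have "card \<dots> = card {w. (u, w) \<in> parcs G}" by (rule card_image) (auto simp: inj_on_def)
  finally show ?thesis by simp
qed

text \<open>The graph is strongly regular with parameters \<open>\<lambda> = 0\<close> and
  \<open>\<mu> = 1\<close>: adjacent vertices have no common neighbour for lack of triangles, and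
  for non-adjacent ones the diameter gives existence and the lack of squares uniqueness.\<close>

lemma card_common_neighbours:
  assumes u: "u \<in> pverts G" and v: "v \<in> pverts G"
  shows "card {w. (u, w) \<in> parcs G \<and> (w, v) \<in> parcs G} =
    (if u = v then k else if (u, v) \<in> parcs G then 0 else 1)"
proof -
  consider "u = v" | "u \<noteq> v" "(u, v) \<in> parcs G" | "u \<noteq> v" "(u, v) \<notin> parcs G" by blast
  then show ?thesis
  proof cases
    case 1
    have "{w. (u, w) \<in> parcs G \<and> (w, u) \<in> parcs G} = {w. (u, w) \<in> parcs G}"
      using arcs_symmetric by blast
    then show ?thesis using 1 card_neighbours[OF u] by simp
  next
    case 2
    then have "{w. (u, w) \<in> parcs G \<and> (w, v) \<in> parcs G} = {}"
      using moore_no_triangle arcs_symmetric by blast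
    then have "card {w. (u, w) \<in> parcs G \<and> (w, v) \<in> parcs G} = card ({} :: 'a set)"
      by (rule arg_cong)
    then show ?thesis using 2 by simp
  next
    case 3
    obtain w where "(u, w) \<in> parcs G" "(w, v) \<in> parcs G"
      using moore_common_neighbour_exists[OF u v 3] by blast
    then have "{w. (u, w) \<in> parcs G \<and> (w, v) \<in> parcs G} = {w}"
      using moore_no_square[of u w v] 3(1) arcs_symmetric by blast
    then show ?thesis using 3 by simp
  qed
qed

lemma sum_adjacency_matrix:
  assumes "u \<in> pverts G"
  shows "(\<Sum>v\<in>pverts G. adjacency_matrix G u v) = int k"
proof -
  have "(\<Sum>v\<in>pverts G. adjacency_matrix G u v) = (\<Sum>v\<in>{v. (u, v) \<in> parcs G}. 1)"
    unfolding adjacency_matrix_def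
    by (rule sum.mono_neutral_cong_right) (use wellformed' in auto)
  then show ?thesis using card_neighbours[OF assms] by simp
qed

lemma adjacency_matrix_square:
  assumes "u \<in> pverts G" "v \<in> pverts G"
  shows "(\<Sum>w\<in>pverts G. adjacency_matrix G u w * adjacency_matrix G w v) =
    (if u = v then int k - 1 else 0) - adjacency_matrix G u v + 1"
proof -
  have "(\<Sum>w\<in>pverts G. adjacency_matrix G u w * adjacency_matrix G w v) =
      (\<Sum>w\<in>{w. (u, w) \<in> parcs G \<and> (w, v) \<in> parcs G}. 1)"
    unfolding adjacency_matrix_def
    by (rule sum.mono_neutral_cong_right) (use wellformed' in auto)
  also have "\<dots> = int (card {w. (u, w) \<in> parcs G \<and> (w, v) \<in> parcs G})" by simp
  finally show ?thesis
    using card_common_neighbours[OF assms] no_loops'[of u v] by (auto simp: adjacency_matrix_def)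
qed

text \<open>Over an empty vertex set the supremum defining the diameter would be
  \<open>- \<infinity>\<close> rather than 2.\<close>

lemma moore_pverts_nonempty: "pverts G \<noteq> {}"
proof
  assume "pverts G = {}"
  then have "graph_diameter G = - \<infinity>" by (simp add: graph_diameter_def bot_ereal_def)
  then show False using moore by (simp add: moore_graph_def)
qed

text \<open>Sum a row of \<open>A^2 = (k - 1) I - A + J\<close> in two ways:
  \<open>k * k = (k - 1) - k + card V\<close>.\<close>

lemma card_moore_graph: "card (pverts G) = k\<^sup>2 + 1"
proof -
  let ?A = "adjacency_matrix G" and ?V = "pverts G"
  obtain u where u: "u \<in> ?V" using moore_pverts_nonempty by blast
  have "(\<Sum>v\<in>?V. \<Sum>w\<in>?V. ?A u w * ?A w v) = (\<Sum>w\<in>?V. ?A u w * (\<Sum>v\<in>?V. ?A w v))"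
    by (subst sum.swap) (simp add: sum_distrib_left)
  also have "\<dots> = int k * int k"
    by (simp add: sum_adjacency_matrix u flip: sum_distrib_right)
  finally have "int k * int k =
      (\<Sum>v\<in>?V. (if u = v then int k - 1 else 0) - ?A u v + 1)"
    using u by (simp add: adjacency_matrix_square)
  also have "\<dots> = int (card ?V) - 1"
    using u by (simp add: sum.distrib sum_subtractf sum_adjacency_matrix)
  finally have "int (card ?V) = int (k\<^sup>2 + 1)" by (simp add: power2_eq_square)
  then show ?thesis by (simp only: of_nat_eq_iff)
qed

section \<open>The quadratic equation of the Laplacian matrix\<close>

lemma laplacian_matrix_moore:
  assumes "u \<in> pverts G"
  shows "laplacian_matrix G u v = (if u = v then int k else 0) - adjacency_matrix G u v"
  using assms moore
  by (auto simp: laplacian_matrix_def degree_matrix_def moore_graph_def regular_graph_def)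

lemma laplacian_matrix_diagonal: "u \<in> pverts G \<Longrightarrow> laplacian_matrix G u u = int k"
  using no_loops'[of u u] by (auto simp: laplacian_matrix_moore adjacency_matrix_def)

lemma laplacian_matrix_sym:
  "u \<in> pverts G \<Longrightarrow> v \<in> pverts G \<Longrightarrow> laplacian_matrix G u v = laplacian_matrix G v u"
  using arcs_symmetric by (auto simp: laplacian_matrix_moore adjacency_matrix_def)

lemma sum_laplacian_matrix:
  assumes "u \<in> pverts G"
  shows "(\<Sum>v\<in>pverts G. laplacian_matrix G u v) = 0"
  using assms by (simp add: laplacian_matrix_moore sum_subtractf sum_adjacency_matrix)

text \<open>Insert \<open>A = k I - L\<close> into the equation for \<open>A^2\<close>. For
  \<open>k = 57\<close> the coefficients are 115 and 3250.\<close>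

lemma laplacian_matrix_square:
  assumes u: "u \<in> pverts G" and v: "v \<in> pverts G"
  shows "(\<Sum>w\<in>pverts G. laplacian_matrix G u w * laplacian_matrix G w v) =
    (2 * int k + 1) * laplacian_matrix G u v - (if u = v then (int k)\<^sup>2 + 1 else 0) + 1"
proof -
  let ?A = "adjacency_matrix G" and ?V = "pverts G" and ?\<delta> = "\<lambda>u v. if u = v then int k else 0"
  have "(\<Sum>w\<in>?V. laplacian_matrix G u w * laplacian_matrix G w v) =
      (\<Sum>w\<in>?V. ?\<delta> u w * ?\<delta> w v - ?\<delta> u w * ?A w v - ?A u w * ?\<delta> w v + ?A u w * ?A w v)"
    by (rule sum.cong) (use u in \<open>auto simp: laplacian_matrix_moore algebra_simps\<close>)
  also have "\<dots> = (\<Sum>w\<in>?V. ?\<delta> u w * ?\<delta> w v) - (\<Sum>w\<in>?V. ?\<delta> u w * ?A w v)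
      - (\<Sum>w\<in>?V. ?A u w * ?\<delta> w v) + (\<Sum>w\<in>?V. ?A u w * ?A w v)"
    by (simp only: sum.distrib sum_subtractf)
  also have "(\<Sum>w\<in>?V. ?\<delta> u w * ?\<delta> w v) = (\<Sum>w\<in>?V. if u = w then int k * ?\<delta> u v else 0)"
    by (rule sum.cong) auto
  also have "\<dots> = int k * ?\<delta> u v" using u by simp
  also have "(\<Sum>w\<in>?V. ?\<delta> u w * ?A w v) = (\<Sum>w\<in>?V. if u = w then int k * ?A u v else 0)"
    by (rule sum.cong) auto
  also have "\<dots> = int k * ?A u v" using u by simp
  also have "(\<Sum>w\<in>?V. ?A u w * ?\<delta> w v) = (\<Sum>w\<in>?V. if w = v then int k * ?A u v else 0)"
    by (rule sum.cong) auto
  also have "\<dots> = int k * ?A u v" using v by simp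
  finally show ?thesis
    unfolding adjacency_matrix_square[OF u v] laplacian_matrix_moore[OF u, of v]
    by (cases "u = v") (simp_all add: power2_eq_square algebra_simps)
qed

end

section \<open>The critical group\<close>

text \<open>The properties of the Laplacian on which the computation of the critical group rests;
  the graph itself no longer appears.\<close>

locale moore57_laplacian =
  fixes V :: "'a set" and L :: "'a \<Rightarrow> 'a \<Rightarrow> int"
  assumes finite_V: "finite V" and card_V: "card V = 3250"
    and diagonal: "u \<in> V \<Longrightarrow> L u u = 57"
    and symmetric: "u \<in> V \<Longrightarrow> v \<in> V \<Longrightarrow> L u v = L v u"
    and row_sum: "u \<in> V \<Longrightarrow> (\<Sum>v\<in>V. L u v) = 0"
    and square: "u \<in> V \<Longrightarrow> v \<in> V \<Longrightarrow>
      (\<Sum>w\<in>V. L u w * L w v) = 115 * L u v - (if u = v then 3250 else 0) + 1"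
begin

section \<open>The Laplacian as an operator on integer vectors\<close>

definition app :: "('a \<Rightarrow> int) \<Rightarrow> 'a \<Rightarrow> int" where
  "app x u = (\<Sum>v\<in>V. L u v * x v)"

text \<open>Vectors are functions on the whole type, group elements are extensional on
  \<open>V\<close>; this passes from one to the other.\<close>

lemma app_cong: "(\<And>v. v \<in> V \<Longrightarrow> x v = y v) \<Longrightarrow> app x u = app y u"
  unfolding app_def by (rule sum.cong) auto

lemma app_add: "app (\<lambda>v. x v + y v) u = app x u + app y u"
  by (simp add: app_def algebra_simps sum.distrib)

lemma app_diff: "app (\<lambda>v. x v - y v) u = app x u - app y u"
  by (simp add: app_def algebra_simps sum_subtractf)

lemma app_scale: "app (\<lambda>v. c * x v) u = c * app x u"
  by (simp add: app_def sum_distrib_left mult_ac)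

lemma app_const: "u \<in> V \<Longrightarrow> app (\<lambda>_. c) u = 0"
  using row_sum[of u] by (simp add: app_def flip: sum_distrib_right)

lemma sum_app: "(\<Sum>u\<in>V. app x u) = 0"
proof -
  have "(\<Sum>u\<in>V. app x u) = (\<Sum>v\<in>V. (\<Sum>u\<in>V. L u v) * x v)"
    unfolding app_def by (subst sum.swap) (simp add: sum_distrib_right)
  also have "\<dots> = (\<Sum>v\<in>V. (\<Sum>u\<in>V. L v u) * x v)"
    by (intro sum.cong arg_cong2[of _ _ _ _ "(*)"] refl symmetric)
  finally show ?thesis by (simp add: row_sum)
qed

lemma app_app:
  assumes u: "u \<in> V"
  shows "app (app x) u = 115 * app x u - 3250 * x u + (\<Sum>v\<in>V. x v)"
proof -
  have "app (app x) u = (\<Sum>v\<in>V. (\<Sum>w\<in>V. L u w * L w v) * x v)"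
    unfolding app_def sum_distrib_left by (subst sum.swap) (simp add: sum_distrib_right mult.assoc)
  also have "\<dots> = (\<Sum>v\<in>V. 115 * (L u v * x v) - (if u = v then 3250 * x v else 0) + x v)"
    by (rule sum.cong) (use u in \<open>auto simp: square ring_distribs\<close>)
  also have "\<dots> = 115 * app x u - 3250 * x u + (\<Sum>v\<in>V. x v)"
    using u finite_V by (simp add: app_def sum.distrib sum_subtractf sum_distrib_left)
  finally show ?thesis .
qed

text \<open>If \<open>L x = 0\<close>, the quadratic equation leaves
  \<open>3250 * x u = (\<Sum>v\<in>V. x v)\<close>, which does not depend on
  \<open>u\<close>.\<close>

lemma app_eq_0_imp_const:
  assumes "\<And>u. u \<in> V \<Longrightarrow> app x u = 0" "u \<in> V" "v \<in> V"
  shows "x u = x v"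
proof -
  have "app (app x) w = 0" if "w \<in> V" for w
    using assms(1) by (simp add: app_def)
  then show ?thesis using app_app[of u x] app_app[of v x] assms by simp
qed

text \<open>On vectors of sum zero \<open>J\<close> vanishes, and the quadratic equation becomes
  \<open>L (115 x - L x) = 3250 x\<close>.\<close>

lemma sum_zero_imp_3250_in_image:
  assumes "(\<Sum>v\<in>V. x v) = 0"
  obtains z where "\<And>u. u \<in> V \<Longrightarrow> 3250 * x u = app z u"
proof
  fix u assume "u \<in> V"
  then show "3250 * x u = app (\<lambda>v. 115 * x v - app x v) u"
    using assms by (simp add: app_diff app_scale app_app)
qed

section \<open>The cokernel and its torsion subgroup\<close>

definition vertex_lattice :: "('a \<Rightarrow> int) monoid" where
  "vertex_lattice = product_group V (\<lambda>_. integer_group)"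

definition lap_image :: "('a \<Rightarrow> int) set" where
  "lap_image = (\<lambda>x. \<lambda>u\<in>V. app x u) ` carrier vertex_lattice"

definition coker :: "('a \<Rightarrow> int) set monoid" where
  "coker = vertex_lattice Mod lap_image"

definition cls :: "('a \<Rightarrow> int) \<Rightarrow> ('a \<Rightarrow> int) set" where
  "cls x = lap_image #>\<^bsub>vertex_lattice\<^esub> restrict x V"

lemma comm_group_lattice: "comm_group vertex_lattice"
  unfolding vertex_lattice_def
  by (rule group.group_comm_groupI) (auto simp: add.commute)

lemma carrier_lattice: "carrier vertex_lattice = extensional V"
  by (auto simp: vertex_lattice_def PiE_iff extensional_def)

lemma subgroup_image: "subgroup lap_image vertex_lattice"
proof -
  interpret comm_group vertex_lattice by (rule comm_group_lattice)
  have "(\<lambda>x. \<lambda>u\<in>V. app x u) \<in> hom vertex_lattice vertex_lattice"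
    by (rule homI) (auto simp: vertex_lattice_def fun_eq_iff simp flip: app_add intro!: app_cong)
  then interpret group_hom vertex_lattice vertex_lattice "\<lambda>x. \<lambda>u\<in>V. app x u"
    by unfold_locales
  show ?thesis unfolding lap_image_def by (rule img_is_subgroup)
qed

lemma normal_image: "lap_image \<lhd> vertex_lattice"
  using comm_group.subgroup_imp_normal[OF comm_group_lattice subgroup_image] .

lemma restrict_in_image_iff: "restrict x V \<in> lap_image \<longleftrightarrow> (\<exists>z. \<forall>u\<in>V. x u = app z u)"
proof
  assume "restrict x V \<in> lap_image"
  then show "\<exists>z. \<forall>u\<in>V. x u = app z u"
    unfolding lap_image_def by (metis (no_types, lifting) imageE restrict_apply')
next
  assume "\<exists>z. \<forall>u\<in>V. x u = app z u"
  then obtain z where "\<forall>u\<in>V. x u = app z u" by blast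
  then have "restrict x V = (\<lambda>u\<in>V. app (restrict z V) u)"
    by (auto simp: fun_eq_iff intro!: app_cong)
  then show "restrict x V \<in> lap_image" unfolding lap_image_def carrier_lattice by blast
qed

text \<open>Reduces equality of cosets to solving a linear system, so that later arguments can work
  with plain integer vectors.\<close>

lemma cls_eq_iff: "cls x = cls y \<longleftrightarrow> (\<exists>z. \<forall>u\<in>V. x u = y u + app z u)"
proof -
  interpret comm_group vertex_lattice by (rule comm_group_lattice)
  interpret im: subgroup lap_image vertex_lattice by (rule subgroup_image)
  have car: "restrict x V \<in> carrier vertex_lattice" "restrict y V \<in> carrier vertex_lattice"
    by (simp_all add: carrier_lattice)
  have "cls x = cls y \<longleftrightarrow> restrict x V \<in> lap_image #>\<^bsub>vertex_lattice\<^esub> restrict y V"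
    unfolding cls_def using car repr_independence rcos_self subgroup_image by metis
  also have "\<dots> \<longleftrightarrow> restrict x V \<otimes>\<^bsub>vertex_lattice\<^esub> inv\<^bsub>vertex_lattice\<^esub> restrict y V \<in> lap_image"
    using im.rcos_module[OF is_group car(2,1)] .
  also have "inv\<^bsub>vertex_lattice\<^esub> restrict y V = (\<lambda>u\<in>V. - y u)"
    unfolding vertex_lattice_def by (subst inv_product_group) auto
  also have "restrict x V \<otimes>\<^bsub>vertex_lattice\<^esub> (\<lambda>u\<in>V. - y u) = (\<lambda>u\<in>V. x u - y u)"
    by (auto simp: vertex_lattice_def)
  also have "(\<lambda>u\<in>V. x u - y u) \<in> lap_image \<longleftrightarrow> (\<exists>z. \<forall>u\<in>V. x u - y u = app z u)"
    by (rule restrict_in_image_iff)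
  finally show ?thesis by (simp add: algebra_simps)
qed

lemma cls_eqI: "(\<And>u. u \<in> V \<Longrightarrow> x u = y u + app z u) \<Longrightarrow> cls x = cls y"
  using cls_eq_iff by blast

lemma comm_group_coker: "comm_group coker"
  unfolding coker_def by (rule comm_group.abelian_FactGroup[OF comm_group_lattice subgroup_image])

lemma carrier_coker: "carrier coker = range cls"
proof -
  have "carrier coker = (\<lambda>x. lap_image #>\<^bsub>vertex_lattice\<^esub> x) ` extensional V"
    by (auto simp: coker_def FactGroup_def RCOSETS_def carrier_lattice)
  also have "\<dots> = range cls"
    unfolding cls_def lap_image_def by (auto simp: extensional_restrict image_iff) (metis extensional_restrict)
  finally show ?thesis .
qed

lemma mult_cls: "cls x \<otimes>\<^bsub>coker\<^esub> cls y = cls (\<lambda>u. x u + y u)"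
proof -
  interpret normal lap_image vertex_lattice by (rule normal_image)
  have "cls x \<otimes>\<^bsub>coker\<^esub> cls y = lap_image #>\<^bsub>vertex_lattice\<^esub> (restrict x V \<otimes>\<^bsub>vertex_lattice\<^esub> restrict y V)"
    by (simp add: coker_def FactGroup_def cls_def rcos_sum carrier_lattice)
  also have "restrict x V \<otimes>\<^bsub>vertex_lattice\<^esub> restrict y V = (\<lambda>u\<in>V. x u + y u)"
    by (auto simp: vertex_lattice_def)
  finally show ?thesis by (simp only: cls_def)
qed

lemma one_coker: "\<one>\<^bsub>coker\<^esub> = cls (\<lambda>_. 0)"
proof -
  interpret comm_group coker by (rule comm_group_coker)
  have "cls (\<lambda>_. 0) \<otimes>\<^bsub>coker\<^esub> cls (\<lambda>_. 0) = cls (\<lambda>_. 0)" by (simp add: mult_cls)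
  moreover have "cls (\<lambda>_. 0) \<in> carrier coker" by (simp add: carrier_coker)
  ultimately show ?thesis using l_cancel_one by metis
qed

lemma pow_cls: "cls x [^]\<^bsub>coker\<^esub> (n::nat) = cls (\<lambda>u. int n * x u)"
proof -
  interpret comm_group coker by (rule comm_group_coker)
  show ?thesis
    by (induction n) (simp_all add: one_coker mult_cls algebra_simps)
qed

lemma cls_eq_one_iff: "cls x = \<one>\<^bsub>coker\<^esub> \<longleftrightarrow> (\<exists>z. \<forall>u\<in>V. x u = app z u)"
  by (simp add: one_coker cls_eq_iff)

text \<open>Vectors in the image have sum zero, so a class with a multiple in the image has sum zero
  too; conversely 3250 kills every class of sum zero.\<close>

lemma torsion_coker: "torsion_subgroup coker = cls ` {x. (\<Sum>v\<in>V. x v) = 0}"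
proof
  show "torsion_subgroup coker \<subseteq> cls ` {x. (\<Sum>v\<in>V. x v) = 0}"
  proof
    fix C assume C: "C \<in> torsion_subgroup coker"
    then obtain x n where x: "C = cls x" and n: "0 < n" "C [^]\<^bsub>coker\<^esub> (n::nat) = \<one>\<^bsub>coker\<^esub>"
      by (auto simp: torsion_subgroup_def carrier_coker)
    then obtain z where "\<forall>u\<in>V. int n * x u = app z u"
      unfolding x pow_cls cls_eq_one_iff by blast
    then have "int n * (\<Sum>u\<in>V. x u) = (\<Sum>u\<in>V. app z u)" by (simp add: sum_distrib_left)
    then show "C \<in> cls ` {x. (\<Sum>v\<in>V. x v) = 0}" using n x by (simp add: sum_app)
  qed
  show "cls ` {x. (\<Sum>v\<in>V. x v) = 0} \<subseteq> torsion_subgroup coker"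
  proof clarify
    fix x :: "'a \<Rightarrow> int" assume "(\<Sum>v\<in>V. x v) = 0"
    then obtain z where "\<And>u. u \<in> V \<Longrightarrow> 3250 * x u = app z u" using sum_zero_imp_3250_in_image by blast
    then have "cls x [^]\<^bsub>coker\<^esub> (3250::nat) = \<one>\<^bsub>coker\<^esub>"
      unfolding pow_cls cls_eq_one_iff by auto
    then show "cls x \<in> torsion_subgroup coker"
      unfolding torsion_subgroup_def carrier_coker by (auto intro!: exI[of _ 3250])
  qed
qed

definition crit :: "('a \<Rightarrow> int) set monoid" where
  "crit = coker\<lparr>carrier := torsion_subgroup coker\<rparr>"

lemma carrier_crit: "carrier crit = cls ` {x. (\<Sum>v\<in>V. x v) = 0}"
  by (simp add: crit_def torsion_coker)

lemma pow_crit: "C [^]\<^bsub>crit\<^esub> (n::nat) = C [^]\<^bsub>coker\<^esub> n"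
  using monoid.nat_pow_consistent[of coker C n] comm_group_coker
  by (simp add: crit_def comm_group_def comm_monoid_def)

lemma one_crit: "\<one>\<^bsub>crit\<^esub> = \<one>\<^bsub>coker\<^esub>"
  by (simp add: crit_def)

lemma comm_group_crit: "comm_group crit"
proof -
  interpret comm_group coker by (rule comm_group_coker)
  have "subgroup (torsion_subgroup coker) coker"
  proof (rule subgroupI)
    show "torsion_subgroup coker \<subseteq> carrier coker" by (auto simp: torsion_subgroup_def)
    show "torsion_subgroup coker \<noteq> {}" by (auto simp: torsion_coker intro: exI[of _ "\<lambda>_. 0"])
    show "inv\<^bsub>coker\<^esub> C \<in> torsion_subgroup coker" if "C \<in> torsion_subgroup coker" for C
      using that by (auto simp: torsion_subgroup_def nat_pow_inv)
    show "C \<otimes>\<^bsub>coker\<^esub> D \<in> torsion_subgroup coker"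
      if "C \<in> torsion_subgroup coker" "D \<in> torsion_subgroup coker" for C D
      using that unfolding torsion_coker
      by (auto simp: mult_cls sum.distrib intro!: imageI)
  qed
  then show ?thesis unfolding crit_def
    by (intro group.group_comm_groupI subgroup.subgroup_is_group[OF _ is_group])
      (auto simp: torsion_subgroup_def m_comm)
qed

lemma exponent_crit: "C \<in> carrier crit \<Longrightarrow> C [^]\<^bsub>crit\<^esub> (3250::nat) = \<one>\<^bsub>crit\<^esub>"
proof -
  assume "C \<in> carrier crit"
  then obtain x where x: "C = cls x" "(\<Sum>v\<in>V. x v) = 0" by (auto simp: carrier_crit)
  obtain z where "\<And>u. u \<in> V \<Longrightarrow> 3250 * x u = app z u"
    using sum_zero_imp_3250_in_image[OF x(2)] by blast
  then show ?thesis
    unfolding pow_crit one_crit x(1) pow_cls cls_eq_one_iff by auto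
qed

text \<open>Sum-zero representatives that agree modulo 3250 differ by \<open>3250 * y\<close> with
  \<open>y\<close> of sum zero, hence by an element of the image. A class is thus determined by
  residues modulo 3250.\<close>

lemma finite_crit: "finite (carrier crit)"
proof -
  define r where "r C = (SOME x. C = cls x \<and> (\<Sum>v\<in>V. x v) = 0)" for C
  have r: "C = cls (r C)" "(\<Sum>v\<in>V. r C v) = 0" if "C \<in> carrier crit" for C
  proof -
    have "\<exists>x. C = cls x \<and> (\<Sum>v\<in>V. x v) = 0" using that by (auto simp: carrier_crit)
    then have "C = cls (r C) \<and> (\<Sum>v\<in>V. r C v) = 0" unfolding r_def by (rule someI_ex)
    then show "C = cls (r C)" "(\<Sum>v\<in>V. r C v) = 0" by blast+
  qed
  let ?f = "\<lambda>C. \<lambda>v\<in>V. r C v mod 3250"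
  have "inj_on ?f (carrier crit)"
  proof (rule inj_onI)
    fix C D assume CD: "C \<in> carrier crit" "D \<in> carrier crit" "?f C = ?f D"
    have "r C v mod 3250 = r D v mod 3250" if "v \<in> V" for v
      using fun_cong[OF CD(3), of v] that by simp
    then have d: "3250 dvd r C v - r D v" if "v \<in> V" for v
      using that by (simp add: mod_eq_dvd_iff)
    define y where "y v = (r C v - r D v) div 3250" for v
    have y: "r C v = r D v + 3250 * y v" if "v \<in> V" for v using d[OF that] by (simp add: y_def)
    have "(\<Sum>v\<in>V. r C v) = (\<Sum>v\<in>V. r D v) + 3250 * (\<Sum>v\<in>V. y v)"
      by (simp add: y sum.distrib sum_distrib_left)
    then have "(\<Sum>v\<in>V. y v) = 0" using r(2)[OF CD(1)] r(2)[OF CD(2)] by simp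
    then obtain z where "\<And>u. u \<in> V \<Longrightarrow> 3250 * y u = app z u"
      using sum_zero_imp_3250_in_image by blast
    then have "cls (r C) = cls (r D)" using y by (intro cls_eqI[of _ _ z]) simp
    then show "C = D" using r(1)[OF CD(1)] r(1)[OF CD(2)] by simp
  qed
  moreover have "?f ` carrier crit \<subseteq> V \<rightarrow>\<^sub>E {0..<3250}" by auto
  moreover have "finite (V \<rightarrow>\<^sub>E {0..<3250::int})" using finite_V by (intro finite_PiE) auto
  ultimately show ?thesis using inj_on_finite by blast
qed

section \<open>Eigenspaces of the Laplacian modulo a prime\<close>

definition shifted :: "int \<Rightarrow> 'a \<Rightarrow> 'a \<Rightarrow> int" where
  "shifted l u v = L u v - (if u = v then l else 0)"

lemma sum_shifted:
  assumes "u \<in> V"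
  shows "(\<Sum>v\<in>V. shifted l u v * x v) = app x u - l * x u"
proof -
  have "(\<Sum>v\<in>V. shifted l u v * x v) = (\<Sum>v\<in>V. L u v * x v - (if u = v then l * x v else 0))"
    by (rule sum.cong) (auto simp: shifted_def ring_distribs)
  then show ?thesis using assms finite_V by (simp add: app_def sum_subtractf)
qed

lemma kernel_mod_shifted:
  "kernel_mod p V (shifted l) =
    {x \<in> V \<rightarrow>\<^sub>E {0..<int p}. \<forall>u\<in>V. int p dvd app x u - l * x u}"
  by (auto simp: kernel_mod_def sum_shifted)

lemma kernel_mod_L:
  "kernel_mod p V L = {x \<in> V \<rightarrow>\<^sub>E {0..<int p}. \<forall>u\<in>V. int p dvd app x u}"
  by (simp add: kernel_mod_def app_def)

text \<open>Identifies the kernel of \<open>L\<close> with the eigenspace of 50 modulo 2 and with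
  that of 65 modulo 13.\<close>

lemma kernel_mod_shifted_eq:
  assumes "int p dvd l"
  shows "kernel_mod p V (shifted l) = kernel_mod p V L"
  using assms by (auto simp: kernel_mod_shifted kernel_mod_L dvd_diff_left_iff)

text \<open>Adding a multiple of the all-ones matrix \<open>J\<close> to a multiple of \<open>L - l I\<close>, for an eigenvalue
  \<open>l\<close> of \<open>L\<close>, so that the all-ones vector is killed too, gives 15 times an idempotent
  (the difference of the eigenvalues 65 and 50 is 15).\<close>

lemma square_shifted_rat:
  fixes s a b :: rat
  assumes u: "u \<in> V" and v: "v \<in> V"
  defines "E \<equiv> \<lambda>u v. s * of_int (L u v) + (if u = v then a else 0) + b"
  shows "(\<Sum>w\<in>V. E u w * E w v) = (115 * s\<^sup>2 + 2 * s * a) * of_int (L u v)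
    + (if u = v then a\<^sup>2 - 3250 * s\<^sup>2 else 0) + (s\<^sup>2 + 2 * a * b + 3250 * b\<^sup>2)"
proof -
  let ?L = "\<lambda>u v. of_int (L u v) :: rat" and ?d = "\<lambda>u v. if u = v then a else 0"
  have 1: "(\<Sum>w\<in>V. ?L u w * ?L w v) = 115 * ?L u v - (if u = v then 3250 else 0) + 1"
  proof -
    have "(\<Sum>w\<in>V. ?L u w * ?L w v) = of_int (\<Sum>w\<in>V. L u w * L w v)" by simp
    then show ?thesis by (simp add: square u v)
  qed
  have 2: "(\<Sum>w\<in>V. ?L u w) = 0" "(\<Sum>w\<in>V. ?L w v) = 0"
  proof -
    have "(\<Sum>w\<in>V. ?L u w) = of_int (\<Sum>w\<in>V. L u w)" by simp
    then show "(\<Sum>w\<in>V. ?L u w) = 0" by (simp add: row_sum u)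
    have "(\<Sum>w\<in>V. ?L w v) = of_int (\<Sum>w\<in>V. L w v)" by simp
    also have "(\<Sum>w\<in>V. L w v) = (\<Sum>w\<in>V. L v w)" by (rule sum.cong) (auto intro: symmetric v)
    finally show "(\<Sum>w\<in>V. ?L w v) = 0" by (simp add: row_sum v)
  qed
  have 3: "(\<Sum>w\<in>V. ?d u w * f w) = a * f u" "(\<Sum>w\<in>V. f w * ?d w v) = a * f v" for f :: "'a \<Rightarrow> rat"
  proof -
    have "(\<Sum>w\<in>V. ?d u w * f w) = (\<Sum>w\<in>V. if u = w then a * f w else 0)" by (rule sum.cong) auto
    then show "(\<Sum>w\<in>V. ?d u w * f w) = a * f u" using u finite_V by simp
    have "(\<Sum>w\<in>V. f w * ?d w v) = (\<Sum>w\<in>V. if w = v then a * f w else 0)" by (rule sum.cong) auto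
    then show "(\<Sum>w\<in>V. f w * ?d w v) = a * f v" using v finite_V by simp
  qed
  have "(\<Sum>w\<in>V. E u w * E w v) = (\<Sum>w\<in>V. s\<^sup>2 * (?L u w * ?L w v) + s * (?L u w * ?d w v)
      + s * b * ?L u w + s * (?d u w * ?L w v) + ?d u w * ?d w v + b * (?d u w * 1)
      + s * b * ?L w v + b * (1 * ?d w v) + b\<^sup>2)"
    unfolding E_def by (rule sum.cong) (auto simp: algebra_simps power2_eq_square)
  also have "\<dots> = s\<^sup>2 * (\<Sum>w\<in>V. ?L u w * ?L w v) + s * (\<Sum>w\<in>V. ?L u w * ?d w v)
      + s * b * (\<Sum>w\<in>V. ?L u w) + s * (\<Sum>w\<in>V. ?d u w * ?L w v) + (\<Sum>w\<in>V. ?d u w * ?d w v)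
      + b * (\<Sum>w\<in>V. ?d u w * 1) + s * b * (\<Sum>w\<in>V. ?L w v) + b * (\<Sum>w\<in>V. 1 * ?d w v) + (\<Sum>w\<in>V. b\<^sup>2)"
    by (simp only: sum.distrib sum_distrib_left)
  also have "\<dots> = s\<^sup>2 * (115 * ?L u v - (if u = v then 3250 else 0) + 1) + s * (a * ?L u v)
      + s * (a * ?L u v) + a * ?d u v + b * a + b * a + 3250 * b\<^sup>2"
    unfolding 1 2 3 by (simp add: card_V)
  finally show ?thesis by (cases "u = v") (simp_all add: algebra_simps power2_eq_square)
qed

text \<open>Over the rationals \<open>L - 65 I\<close> has rank at most \<open>1729 + 1\<close>, the
  last 1 for the all-ones vector, which leaves a nullity of at least
  \<open>3250 - 1730 = 1520\<close>.\<close>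

lemma card_kernel_mod_shifted_65:
  assumes "prime p"
  shows "p ^ 1520 \<le> card (kernel_mod p V (shifted 65))"
proof -
  \<comment> \<open>This is \<open>65 I - L - J / 50\<close>: it is 15 on the eigenvalue 50, and it
    kills the all-ones vector because \<open>65 = 3250 / 50\<close>.\<close>
  let ?E = "\<lambda>u v. (-1) * of_int (L u v) + (if u = v then 65 else 0) + (- 1 / 50) :: rat"
  have "card S \<le> 1729 + 1" if "S \<subseteq> V" "independent_columns V (shifted 65) S" for S
  proof (rule card_independent_columns_le[where E = ?E and t = 15 and a = "-1" and b = "- 1 / 50"])
    fix u v assume "u \<in> V" "v \<in> V"
    then show "(\<Sum>w\<in>V. ?E u w * ?E w v) = 15 * ?E u v"
      by (subst square_shifted_rat) (simp_all add: power2_eq_square)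
    show "of_int (shifted 65 u v) = - 1 * ?E u v + - 1 / 50"
      by (simp add: shifted_def)
  next
    \<comment> \<open>Each diagonal entry is \<open>65 - 57 - 1 / 50\<close>, and
      \<open>3250 * 399 / 50 = 1729 * 15\<close>.\<close>
    have "(\<Sum>v\<in>V. ?E v v) = (\<Sum>v\<in>V. 399 / 50)" by (rule sum.cong) (auto simp: diagonal)
    then show "(\<Sum>v\<in>V. ?E v v) = of_nat 1729 * 15" by (simp add: card_V)
  qed (use finite_V that in auto)
  then have "p ^ (card V - (1729 + 1)) \<le> card (kernel_mod p V (shifted 65))"
    by (rule card_kernel_mod_ge[OF finite_V assms])
  then show ?thesis by (simp add: card_V)
qed

lemma card_kernel_mod_shifted_50:
  assumes "prime p"
  shows "p ^ 1729 \<le> card (kernel_mod p V (shifted 50))"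
proof -
  \<comment> \<open>This is \<open>L - 50 I + J / 65\<close>: it is 15 on the eigenvalue 65, and it
    kills the all-ones vector because \<open>50 = 3250 / 65\<close>. Its trace is
    \<open>3250 * 456 / 65 = 1520 * 15\<close>.\<close>
  let ?E = "\<lambda>u v. 1 * of_int (L u v) + (if u = v then - 50 else 0) + 1 / 65 :: rat"
  have "card S \<le> 1520 + 1" if "S \<subseteq> V" "independent_columns V (shifted 50) S" for S
  proof (rule card_independent_columns_le[where E = ?E and t = 15 and a = 1 and b = "- 1 / 65"])
    fix u v assume "u \<in> V" "v \<in> V"
    then show "(\<Sum>w\<in>V. ?E u w * ?E w v) = 15 * ?E u v"
      by (subst square_shifted_rat) (simp_all add: power2_eq_square)
    show "of_int (shifted 50 u v) = 1 * ?E u v + - 1 / 65"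
      by (simp add: shifted_def)
  next
    have "(\<Sum>v\<in>V. ?E v v) = (\<Sum>v\<in>V. 456 / 65)" by (rule sum.cong) (auto simp: diagonal)
    then show "(\<Sum>v\<in>V. ?E v v) = of_nat 1520 * 15" by (simp add: card_V)
  qed (use finite_V that in auto)
  then have "p ^ (card V - (1520 + 1)) \<le> card (kernel_mod p V (shifted 50))"
    by (rule card_kernel_mod_ge[OF finite_V assms])
  then show ?thesis by (simp add: card_V)
qed

text \<open>Addition maps the product of the two eigenspaces injectively into all vectors modulo
  \<open>p\<close>, and its image misses a unit vector.\<close>

lemma card_kernel_mod_mult_less:
  assumes p: "prime p" and m: "\<not> int p dvd m" "int p dvd 115 - m" "p dvd 3250"
  shows "card (kernel_mod p V L) * card (kernel_mod p V (shifted m)) < p ^ card V"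
proof -
  let ?A = "kernel_mod p V L" and ?B = "kernel_mod p V (shifted m)" and ?W = "V \<rightarrow>\<^sub>E {0..<int p}"
  let ?f = "\<lambda>(x, y). \<lambda>v\<in>V. (x v + y v) mod int p"
  have p1: "1 < int p" using prime_gt_1_nat[OF p] by simp
  have appmod: "int p dvd app x u - app y u"
    if "\<And>v. v \<in> V \<Longrightarrow> int p dvd x v - y v" for x y u
  proof -
    have "int p dvd app (\<lambda>v. x v - y v) u" unfolding app_def using that by (intro dvd_sum) simp
    then show ?thesis by (simp add: app_diff)
  qed
  have inj: "inj_on ?f (?A \<times> ?B)"
  proof (rule inj_onI, clarify)
    fix x y x' y' assume x: "x \<in> ?A" and y: "y \<in> ?B" and x': "x' \<in> ?A" and y': "y' \<in> ?B"
      and eq: "(\<lambda>v\<in>V. (x v + y v) mod int p) = (\<lambda>v\<in>V. (x' v + y' v) mod int p)"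
    have d: "int p dvd (x v - x' v) - (y' v - y v)" if "v \<in> V" for v
      using fun_cong[OF eq, of v] that by (simp add: mod_eq_dvd_iff algebra_simps)
    \<comment> \<open>Modulo \<open>p\<close>, \<open>x - x'\<close> equals \<open>y' - y\<close>.
      Applying \<open>L\<close> kills the first and multiplies the second by \<open>m\<close>, which
      is invertible, so both vanish.\<close>
    have xx: "int p dvd x v - x' v" if v: "v \<in> V" for v
    proof -
      have h1: "int p dvd app (\<lambda>v. x v - x' v) v - app (\<lambda>v. y' v - y v) v"
        by (rule appmod) (rule d)
      have h2: "int p dvd app x v - app x' v"
        using x x' v by (auto simp: kernel_mod_L)
      have h3: "int p dvd (app y' v - m * y' v) - (app y v - m * y v)"
        using y y' v by (intro dvd_diff[of _ "app y' v - m * y' v"]) (auto simp: kernel_mod_shifted)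
      have "int p dvd (app x v - app x' v) - ((app x v - app x' v) - (app y' v - app y v))
          - ((app y' v - m * y' v) - (app y v - m * y v))"
        by (rule dvd_diff[OF dvd_diff[OF h2 h1[unfolded app_diff]] h3])
      then have "int p dvd m * (y' v - y v)" by (simp add: algebra_simps)
      then have "int p dvd y' v - y v" using m(1) p by (simp add: prime_dvd_mult_iff)
      then have "int p dvd ((x v - x' v) - (y' v - y v)) + (y' v - y v)"
        using d[OF v] by (intro dvd_add)
      then show ?thesis by simp
    qed
    have "int p dvd y v - y' v" if "v \<in> V" for v
    proof -
      have "int p dvd (x v - x' v) - ((x v - x' v) - (y' v - y v))"
        by (rule dvd_diff[OF xx[OF that] d[OF that]])
      then show ?thesis by (simp add: dvd_diff_commute)
    qed
    moreover have eqI: "x = x'" if "x \<in> ?W" "x' \<in> ?W" "\<And>v. v \<in> V \<Longrightarrow> int p dvd x v - x' v" for x x'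
    proof (rule PiE_ext[OF that(1,2)])
      fix v assume v: "v \<in> V"
      then have "x v \<in> {0..<int p}" "x' v \<in> {0..<int p}" using that(1,2) by auto
      then show "x v = x' v" using that(3)[OF v]
        by (metis atLeastLessThan_iff mod_eq_dvd_iff mod_pos_pos_trivial)
    qed
    ultimately show "x = x' \<and> y = y'"
      using x x' y y' xx eqI[of x x'] eqI[of y y'] by (auto simp: kernel_mod_def)
  qed
  obtain v0 where v0: "v0 \<in> V" using card_V by fastforce
  let ?e = "\<lambda>v\<in>V. if v = v0 then 1 else (0::int)"
  have "?e \<notin> ?f ` (?A \<times> ?B)"
  proof
    assume "?e \<in> ?f ` (?A \<times> ?B)"
    then obtain x y where x: "x \<in> ?A" and y: "y \<in> ?B" and e: "?e = (\<lambda>v\<in>V. (x v + y v) mod int p)"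
      by auto
    define e :: "'a \<Rightarrow> int" where "e = (\<lambda>v. if v = v0 then 1 else 0)"
    have d: "int p dvd (x v + y v) - e v" if "v \<in> V" for v
    proof -
      have "e v = (x v + y v) mod int p" using fun_cong[OF e, of v] that by (simp add: e_def)
      then show ?thesis by (simp add: dvd_minus_mod)
    qed
    \<comment> \<open>\<open>L (L - m)\<close> kills \<open>x + y\<close> modulo \<open>p\<close>, but maps \<open>e\<close> to the all-ones vector.\<close>
    let ?T = "\<lambda>z. \<lambda>v. app z v - m * z v"
    have Tp: "int p dvd ?T x' v - ?T y' v" if "\<And>v. v \<in> V \<Longrightarrow> int p dvd x' v - y' v" "v \<in> V" for x' y' v
    proof -
      have "int p dvd (app x' v - app y' v) - m * (x' v - y' v)"
        by (rule dvd_diff[OF appmod[OF that(1)] dvd_mult[OF that(1)[OF that(2)]]])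
      then show ?thesis by (simp add: algebra_simps)
    qed
    have h1: "int p dvd app (?T (\<lambda>v. x v + y v)) v0 - app (?T e) v0"
      by (rule appmod) (rule Tp[OF d])
    have h2: "app (?T e) v0 = (115 - m) * app e v0 - 3250 * e v0 + 1"
    proof -
      have "(\<Sum>v\<in>V. e v) = 1" using v0 finite_V by (simp add: e_def)
      then show ?thesis by (simp add: app_diff app_scale app_app v0 algebra_simps)
    qed
    have h3: "int p dvd app (?T (\<lambda>v. x v + y v)) v0"
    proof -
      have Tx: "int p dvd app (?T x) v0"
      proof -
        have ax: "int p dvd app x v - 0" if "v \<in> V" for v using x that by (simp add: kernel_mod_L)
        have "int p dvd app (app x) v0 - app (\<lambda>_. 0) v0" by (rule appmod) (rule ax)
        then have "int p dvd app (app x) v0" by (simp add: app_def)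
        then show ?thesis using ax[OF v0] by (simp add: app_diff app_scale)
      qed
      have "int p dvd ?T y v - 0" if "v \<in> V" for v using y that by (simp add: kernel_mod_shifted)
      then have "int p dvd app (?T y) v0 - app (\<lambda>_. 0) v0" by (rule appmod)
      then have "int p dvd app (?T y) v0" by (simp add: app_def)
      moreover have "app (?T (\<lambda>v. x v + y v)) v0 = app (?T x) v0 + app (?T y) v0"
        by (simp add: app_add app_diff app_scale algebra_simps)
      ultimately show ?thesis using Tx by simp
    qed
    \<comment> \<open>So only the final 1 in \<open>h2\<close> survives modulo \<open>p\<close>; it
      is the coordinate sum of \<open>e\<close>.\<close>
    have h4: "int p dvd (115 - m) * app e v0 - 3250 * e v0"
      using m(2,3) by (intro dvd_diff) (auto simp: int_dvd_int_iff[of p 3250, simplified])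
    have "int p dvd app (?T e) v0" using dvd_diff[OF h3 h1] by (simp only: diff_diff_eq2 add_diff_cancel_left')
    then have "int p dvd 1" using h4 unfolding h2 by (simp only: dvd_add_right_iff)
    then show False using p1 by simp
  qed
  moreover have "?e \<in> ?W" using p1 by auto
  moreover have "?f ` (?A \<times> ?B) \<subseteq> ?W" using p1 by auto
  ultimately have "?f ` (?A \<times> ?B) \<subset> ?W" by blast
  then have "card (?f ` (?A \<times> ?B)) < card ?W"
    using finite_V by (intro psubset_card_mono finite_PiE) auto
  then show ?thesis using card_image[OF inj] finite_V by (simp add: card_cartesian_product card_PiE)
qed

section \<open>The prime parts of the critical group\<close>

text \<open>Passing from \<open>x\<close> to the class of \<open>L x / p\<close> forgets exactly a
  constant vector modulo \<open>p\<close>. Recording the coordinate at \<open>v0\<close> restores it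
  and accounts for the factor \<open>p\<close>.\<close>

lemma card_kernel_mod_L:
  assumes p: "prime p"
  shows "card (kernel_mod p V L) = card (torsion_part crit p) * p"
proof -
  obtain v0 where v0: "v0 \<in> V" using card_V by fastforce
  have p0: "0 < int p" using prime_gt_0_nat[OF p] by simp
  let ?q = "\<lambda>x u. app x u div int p"
  let ?f = "\<lambda>x. (cls (?q x), x v0)"
  let ?A = "kernel_mod p V L" and ?B = "torsion_part crit p \<times> {0..<int p}"
  have q: "app x u = int p * ?q x u" if "x \<in> ?A" "u \<in> V" for x u
    using that by (auto simp: kernel_mod_L)
  have "bij_betw ?f ?A ?B"
  proof (rule bij_betw_imageI)
    show "inj_on ?f ?A"
    proof (rule inj_onI)
      fix x y assume x: "x \<in> ?A" and y: "y \<in> ?A" and eq: "?f x = ?f y"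
      then obtain z where z: "\<And>u. u \<in> V \<Longrightarrow> ?q x u = ?q y u + app z u"
        using cls_eq_iff[of "?q x" "?q y"] by auto
      \<comment> \<open>Vectors killed by \<open>L\<close> are constant, so with
        \<open>x v0 = y v0\<close> the difference \<open>x - y\<close> is a multiple of
        \<open>p\<close>.\<close>
      have "app (\<lambda>v. x v - y v - int p * z v) u = 0" if "u \<in> V" for u
      proof -
        have "app (\<lambda>v. x v - y v - int p * z v) u = app x u - app y u - int p * app z u"
          by (simp only: app_diff app_scale)
        also have "\<dots> = int p * (?q x u - ?q y u - app z u)"
          using q[OF x that] q[OF y that] by (simp add: right_diff_distrib)
        finally show ?thesis using z[OF that] by simp
      qed
      then have c: "x v - y v - int p * z v = x v0 - y v0 - int p * z v0" if "v \<in> V" for v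
        using app_eq_0_imp_const[of "\<lambda>v. x v - y v - int p * z v" v v0] that v0 by blast
      have xW: "x \<in> V \<rightarrow>\<^sub>E {0..<int p}" and yW: "y \<in> V \<rightarrow>\<^sub>E {0..<int p}"
        using x y by (auto simp: kernel_mod_L)
      show "x = y"
      proof (rule PiE_ext[OF xW yW])
        fix v assume v: "v \<in> V"
        have "x v - y v = int p * (z v - z v0)" using c[OF v] eq by (simp add: algebra_simps)
        then have "int p dvd x v - y v" by simp
        moreover have "x v \<in> {0..<int p}" "y v \<in> {0..<int p}" using xW yW v by auto
        ultimately show "x v = y v"
          by (metis atLeastLessThan_iff mod_eq_dvd_iff mod_pos_pos_trivial)
      qed
    qed
    show "?f ` ?A = ?B"
    proof
      show "?f ` ?A \<subseteq> ?B"
      proof clarify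
        fix x assume x: "x \<in> ?A"
        have "int p * (\<Sum>u\<in>V. ?q x u) = (\<Sum>u\<in>V. app x u)"
          unfolding sum_distrib_left by (rule sum.cong) (use q[OF x] in auto)
        then have "(\<Sum>u\<in>V. ?q x u) = 0" using p0 by (simp add: sum_app)
        then have "cls (?q x) \<in> carrier crit" by (auto simp: carrier_crit)
        moreover have "cls (?q x) [^]\<^bsub>crit\<^esub> p = \<one>\<^bsub>crit\<^esub>"
          unfolding pow_crit one_crit pow_cls cls_eq_one_iff using q[OF x] by auto
        moreover have "x v0 \<in> {0..<int p}" using x v0 by (auto simp: kernel_mod_L)
        ultimately show "cls (?q x) \<in> torsion_part crit p \<and> x v0 \<in> {0..<int p}"
          by (simp add: torsion_part_def)
      qed
      show "?B \<subseteq> ?f ` ?A"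
      proof clarify
        fix C t assume C: "C \<in> torsion_part crit p" and t: "t \<in> {0..<int p}"
        obtain y where y: "C = cls y" using C by (auto simp: torsion_part_def carrier_crit)
        have "\<exists>z. \<forall>u\<in>V. int p * y u = app z u"
          using C unfolding torsion_part_def pow_crit one_crit y
          by (simp add: pow_cls cls_eq_one_iff)
        then obtain z where z: "\<And>u. u \<in> V \<Longrightarrow> int p * y u = app z u" by blast
        \<comment> \<open>Adding a constant leaves \<open>L z\<close> unchanged and gives the
          prescribed coordinate \<open>t\<close> at \<open>v0\<close>. Reducing modulo
          \<open>p\<close> afterwards changes \<open>L z / p\<close> by \<open>L w\<close>, which
          vanishes in the cokernel.\<close>
        define z' where "z' v = z v + (t - z v0)" for v
        define x where "x = (\<lambda>v\<in>V. z' v mod int p)"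
        define w where "w v = z' v div int p" for v
        have ax: "app x u = int p * (y u - app w u)" if u: "u \<in> V" for u
        proof -
          have "app x u = app (\<lambda>v. z' v - int p * w v) u"
            by (rule app_cong) (simp add: x_def w_def minus_mult_div_eq_mod)
          also have "\<dots> = app z' u - int p * app w u" by (simp add: app_diff app_scale)
          also have "app z' u = app z u" unfolding z'_def app_add using app_const[OF u] by simp
          finally show ?thesis using z[OF u] by (simp add: algebra_simps)
        qed
        then have "x \<in> ?A" using p0 by (auto simp: kernel_mod_L x_def)
        moreover have "cls (?q x) = C"
          unfolding y by (rule sym, rule cls_eqI[of _ _ w]) (use ax p0 in auto)
        moreover have "x v0 = t" using v0 t by (simp add: x_def z'_def)
        ultimately show "(C, t) \<in> ?f ` ?A" by force
      qed
    qed
  qed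
  then show ?thesis using bij_betw_same_card by (fastforce simp: card_cartesian_product)
qed


text \<open>The \<open>p\<close>-torsion has order \<open>p ^ c\<close>, so the kernel of
  \<open>L\<close> has order \<open>p ^ Suc c\<close>. The lower bound gives
  \<open>a \<le> c\<close>; the strict product bound gives \<open>Suc c + b \<le> 3249\<close>, that
  is, \<open>c \<le> a\<close>.\<close>

lemma torsion_part_iso_cyclic_power:
  assumes p: "prime p" and m: "\<not> int p dvd m" "int p dvd 115 - m" "p dvd 3250"
    and a: "p ^ Suc a \<le> card (kernel_mod p V L)"
    and b: "p ^ b \<le> card (kernel_mod p V (shifted m))" and ab: "a + b = 3248"
  shows "crit\<lparr>carrier := torsion_part crit p\<rparr> \<cong> cyclic_power p a"
proof -
  interpret comm_group crit by (rule comm_group_crit)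
  let ?T = "crit\<lparr>carrier := torsion_part crit p\<rparr>"
  interpret T: comm_group ?T by (rule comm_group_torsion_part)
  have fin: "finite (carrier ?T)"
    by (rule finite_subset[OF _ finite_crit]) (auto simp: torsion_part_def)
  have "C [^]\<^bsub>?T\<^esub> p = \<one>\<^bsub>?T\<^esub>" if "C \<in> carrier ?T" for C
    using that by (simp add: torsion_part_def flip: nat_pow_consistent)
  then obtain c where c: "?T \<cong> cyclic_power p c"
    using T.exponent_prime_iso_cyclic_power[OF fin p] by blast
  have p1: "1 < p" by (rule prime_gt_1_nat[OF p])
  have "card (torsion_part crit p) = p ^ c"
    using iso_same_card[OF c] card_cyclic_power[of p c] p1 by simp
  then have card: "card (kernel_mod p V L) = p ^ Suc c" using card_kernel_mod_L[OF p] by simp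
  have "Suc a \<le> Suc c" using a p1 unfolding card by (rule power_le_imp_le_exp[rotated])
  moreover have "p ^ (Suc c + b) < p ^ 3250"
  proof -
    have "p ^ (Suc c + b) \<le> p ^ Suc c * card (kernel_mod p V (shifted m))"
      unfolding power_add using b by (rule mult_le_mono2)
    also have "\<dots> < p ^ 3250" using card_kernel_mod_mult_less[OF p m] unfolding card card_V .
    finally show ?thesis .
  qed
  then have "Suc c + b < 3250" by (rule power_less_imp_less_exp[OF p1])
  ultimately have "c = a" using ab by simp
  then show ?thesis using c by simp
qed

lemma crit_iso:
  obtains e1 e2 e3 where "crit \<cong>
      cyclic_power 2 1728 \<times>\<times> cyclic_power 13 1519 \<times>\<times>
      cyclic_power 5 e1 \<times>\<times> cyclic_power (5^2) e2 \<times>\<times> cyclic_power (5^3) e3"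
proof -
  interpret K: comm_group crit by (rule comm_group_crit)
  let ?T = "\<lambda>n. crit\<lparr>carrier := torsion_part crit n\<rparr>"
  have comm: "comm_group (?T n)" for n by (rule K.comm_group_torsion_part)
  have grp: "group (?T n)" for n using comm[of n] by (simp add: comm_group_def)
  have iso1: "crit \<cong> ?T 2 \<times>\<times> ?T (13 * 5 ^ 3)"
    by (rule K.torsion_part_coprime_iso) (use exponent_crit in simp_all)
  \<comment> \<open>The second splitting takes place inside a torsion part; its pieces are torsion
    parts of the whole group.\<close>
  have part: "torsion_part (?T (13 * 5 ^ 3)) n = torsion_part crit n" if n: "n dvd 13 * 5 ^ 3" for n
  proof -
    obtain k where k: "13 * 5 ^ 3 = n * k" using n unfolding dvd_def by blast
    have "C [^]\<^bsub>crit\<^esub> (n * k) = \<one>\<^bsub>crit\<^esub>" if "C \<in> carrier crit" "C [^]\<^bsub>crit\<^esub> n = \<one>\<^bsub>crit\<^esub>" for C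
      using that by (simp flip: K.nat_pow_pow)
    then show ?thesis unfolding k by (auto simp: torsion_part_def simp flip: K.nat_pow_consistent)
  qed
  have "coprime (13::nat) (5 ^ 3)"
    by (intro coprime_power_right_iff[THEN iffD2] disjI1 primes_coprime) simp_all
  then have "?T (13 * 5 ^ 3) \<cong> ?T (13 * 5 ^ 3)\<lparr>carrier := torsion_part (?T (13 * 5 ^ 3)) 13\<rparr>
      \<times>\<times> ?T (13 * 5 ^ 3)\<lparr>carrier := torsion_part (?T (13 * 5 ^ 3)) (5 ^ 3)\<rparr>"
    by (rule comm_group.torsion_part_coprime_iso[OF comm]) (simp add: torsion_part_def flip: K.nat_pow_consistent)
  then have iso2: "?T (13 * 5 ^ 3) \<cong> ?T 13 \<times>\<times> ?T (5 ^ 3)"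
    using part[of 13] part[of "5 ^ 3"] by simp
  \<comment> \<open>Modulo 2 the eigenvalue 50 vanishes and 65 does not; the rank is
    \<open>1729 - 1\<close>.\<close>
  have two: "?T 2 \<cong> cyclic_power 2 1728"
  proof (rule torsion_part_iso_cyclic_power[where m = 65 and b = 1520])
    show "2 ^ Suc 1728 \<le> card (kernel_mod 2 V L)"
    proof -
      have "Suc 1728 = 1729" "kernel_mod 2 V (shifted 50) = kernel_mod 2 V L"
        by (simp_all add: kernel_mod_shifted_eq)
      then show ?thesis using card_kernel_mod_shifted_50[OF two_is_prime_nat] by (simp only:)
    qed
    show "2 ^ 1520 \<le> card (kernel_mod 2 V (shifted 65))"
      by (rule card_kernel_mod_shifted_65) simp
  qed simp_all
  have prime_13: "prime (13::nat)" by simp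
  \<comment> \<open>Modulo 13 the roles are exchanged: 65 vanishes and 50 does not; the rank is
    \<open>1520 - 1\<close>.\<close>
  have thirteen: "?T 13 \<cong> cyclic_power 13 1519"
  proof (rule torsion_part_iso_cyclic_power[where m = 50 and b = 1729])
    show "13 ^ Suc 1519 \<le> card (kernel_mod 13 V L)"
    proof -
      have "Suc 1519 = 1520" "kernel_mod 13 V (shifted 65) = kernel_mod 13 V L"
        by (simp_all add: kernel_mod_shifted_eq)
      then show ?thesis using card_kernel_mod_shifted_65[OF prime_13] by (simp only:)
    qed
    show "13 ^ 1729 \<le> card (kernel_mod 13 V (shifted 50))"
      by (rule card_kernel_mod_shifted_50) simp
  qed simp_all
  have fin: "finite (carrier (?T (5 ^ 3)))"
    by (rule finite_subset[OF _ finite_crit]) (auto simp: torsion_part_def)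
  \<comment> \<open>Both eigenvalues vanish modulo 5; here only the exponent \<open>5 ^ 3\<close> is
    used, which leaves the three multiplicities open.\<close>
  have "C [^]\<^bsub>?T (5 ^ 3)\<^esub> ((5::nat) ^ 3) = \<one>\<^bsub>?T (5 ^ 3)\<^esub>" if "C \<in> carrier (?T (5 ^ 3))" for C
    using that by (simp add: torsion_part_def flip: K.nat_pow_consistent)
  moreover have "prime (5::nat)" by simp
  ultimately obtain e1 e2 e3 where five:
    "?T (5 ^ 3) \<cong> cyclic_power 5 e1 \<times>\<times> cyclic_power (5\<^sup>2) e2 \<times>\<times> cyclic_power (5 ^ 3) e3"
    using comm_group.exponent_prime_cube_iso_cyclic_powers[OF comm fin, of 5] by blast
  have "crit \<cong> ?T 2 \<times>\<times> ?T 13 \<times>\<times> ?T (5 ^ 3)"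
    by (rule iso_trans[OF iso1 group.DirProd_iso_trans[OF grp iso_refl iso2]])
  also have "\<dots> \<cong> cyclic_power 2 1728 \<times>\<times> cyclic_power 13 1519 \<times>\<times>
      cyclic_power 5 e1 \<times>\<times> cyclic_power (5\<^sup>2) e2 \<times>\<times> cyclic_power (5 ^ 3) e3"
    by (rule group.DirProd_iso_trans[OF grp two group.DirProd_iso_trans[OF grp thirteen five]])
  finally show thesis by (rule that)
qed

end

theorem theoremA:
  fixes G :: "'a pair_pre_digraph"
  assumes "moore_graph G 2 57"
  shows "\<exists>e1 e2 e3 :: nat.
    critical_group G \<cong>
      cyclic_power 2 1728 \<times>\<times> cyclic_power 13 1519 \<times>\<times>
      cyclic_power 5 e1 \<times>\<times> cyclic_power (5^2) e2 \<times>\<times> cyclic_power (5^3) e3"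
proof -
  interpret M: moore57_laplacian "pverts G" "laplacian_matrix G"
  proof
    have "pair_graph G" using assms by (simp add: moore_graph_def)
    then interpret pair_graph G .
    show "finite (pverts G)" by (rule pair_finite_verts)
    show "card (pverts G) = 3250" using card_moore_graph[OF assms] by simp
    fix u v assume u: "u \<in> pverts G"
    show "laplacian_matrix G u u = 57" using laplacian_matrix_diagonal[OF assms u] by simp
    show "(\<Sum>v\<in>pverts G. laplacian_matrix G u v) = 0" by (rule sum_laplacian_matrix[OF assms u])
    assume v: "v \<in> pverts G"
    show "laplacian_matrix G u v = laplacian_matrix G v u"
      by (rule laplacian_matrix_sym[OF assms u v])
    show "(\<Sum>w\<in>pverts G. laplacian_matrix G u w * laplacian_matrix G w v) =
        115 * laplacian_matrix G u v - (if u = v then 3250 else 0) + 1"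
      using laplacian_matrix_square[OF assms u v] by simp
  qed
  \<comment> \<open>With this identity both constructions unfold to the same group, so an equality
    rather than an isomorphism results.\<close>
  have "laplacian_map G = (\<lambda>x. \<lambda>u\<in>pverts G. M.app x u)"
    by (auto simp: fun_eq_iff laplacian_map_def M.app_def)
  then have "critical_group G = M.crit"
    by (simp add: critical_group_def M.crit_def laplacian_cokernel_def M.coker_def vertex_group_def
        M.vertex_lattice_def M.lap_image_def)
  then show ?thesis using M.crit_iso by metis
qed

end
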